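(* Let $n\ge 3$ be an integer and let $1\le p,r\le\infty$. Suppose that $R^*_{C_n}(p\to r)\lesssim 1$. Then the following hold. (1) If $n\ge 3$ is odd, then $(1/p,1/r)$ lies in the convex hull of the points $(0,0)$, $(1,0)$, $\left(\frac{n^2-3n+4}{2n^2-4n+2},\frac{n-2}{2n-2}\right)$ and $\left(0,\frac{n-2}{2n-2}\right)$. (2) If $n\equiv 2\bmod 4$, or $n$ is even and $-1\in\mathbb F$ is a square, then $(1/p,1/r)$ lies in the convex hull of the points $(0,0)$, $(1,0)$, $\left(\frac{n-2}{2n-2},\frac{n-2}{2n-2}\right)$ and $\left(0,\frac{n-2}{2n-2}\right)$. (3) If $n\equiv 0\bmod 4$ and $-1\in\mathbb F$ is not a square, then $(1/p,1/r)$ lies in the convex hull of the points $(0,0)$, $(1,0)$, $\left(\frac{n^2-2n+4}{2n^2-2n},\frac{n-2}{2n-2}\right)$ and $\left(0,\frac{n-2}{2n-2}\right)$.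
   Context: $\mathbb F$ is a finite field of order $p_0^\ell$ with $p_0$ an odd prime; $e:\mathbb F\to\mathbb S^1$ is its canonical additive character $e(t)=e^{2\pi i\,\mathrm{Tr}(t)/p_0}$, with $\mathrm{Tr}$ the trace from $\mathbb F$ to its prime subfield. $\mathbb F^n$ carries counting measure $dx$, and $\mathbb F_*^n$ denotes the dual space (a copy of $\mathbb F^n$). The cone is $C_n=\{\xi\in\mathbb F_*^n:\xi_{n-1}\xi_n=\xi_1^2+\cdots+\xi_{n-2}^2\}$, with normalized surface measure $d\sigma$ giving mass $|C_n|^{-1}$ to each point, so that $\|f\|_{L^p(C_n,d\sigma)}=\big(|C_n|^{-1}\sum_{\xi\in C_n}|f(\xi)|^p\big)^{1/p}$. For $f:C_n\to\mathbb C$ put $(f\,d\sigma)^\vee(x)=\frac1{|C_n|}\sum_{\xi\in C_n}f(\xi)e(x\cdot\xi)$ for $x\in\mathbb F^n$, and $\|h\|_{L^r(\mathbb F^n,dx)}=\big(\sum_{x\in\mathbb F^n}|h(x)|^r\big)^{1/r}$ (with the usual maximum norms for infinite exponents; $1/\infty=0$). $R^*_{C_n}(p\to r)$ is the best (smallest) constant with $\|(f\,d\sigma)^\vee\|_{L^r(\mathbb F^n,dx)}\le R^*_{C_n}(p\to r)\|f\|_{L^p(C_n,d\sigma)}$ for all $f:C_n\to\mathbb C$; it may depend on $\mathbb F$. The notation $R^*_{C_n}(p\to r)\lesssim 1$ (for fixed $n,p,r$) means that $R^*_{C_n}(p\to r)$ is bounded by a constant independent of the field size; in each item this is understood uniformly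 over all finite fields $\mathbb F$ of odd characteristic satisfying that item's hypothesis on $\mathbb F$ (all fields of odd characteristic in case (1) and in case (2) with $n\equiv2\bmod 4$; all those in which $-1$ is a square in case (2) with $n$ even; all those in which $-1$ is not a square in case (3)). *)

theory Defs
  imports "HOL-Analysis.Analysis" "HOL-Algebra.Ring"
begin

section \<open>Finite fields of odd characteristic and the canonical additive character\<close>

definition odd_finite_field :: "('a, 'm) ring_scheme \<Rightarrow> bool" where
  "odd_finite_field F \<longleftrightarrow> field F \<and> finite (carrier F) \<and>
     (\<exists>p0 l :: nat. prime p0 \<and> odd p0 \<and> card (carrier F) = p0 ^ l)"

definition field_prime :: "('a, 'm) ring_scheme \<Rightarrow> nat" where
  "field_prime F = (THE p0. prime p0 \<and> (\<exists>l. card (carrier F) = p0 ^ l))"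

definition field_degree :: "('a, 'm) ring_scheme \<Rightarrow> nat" where
  "field_degree F = (THE l. card (carrier F) = field_prime F ^ l)"

text \<open>The trace from \<open>F\<close> to its prime subfield is the sum of the conjugates
  \<open>t\<close>, \<open>t ^ p0\<close>, \dots, \<open>t ^ (p0 ^ (l - 1))\<close>; it is still an element of \<open>F\<close>.\<close>

definition field_trace :: "('a, 'm) ring_scheme \<Rightarrow> 'a \<Rightarrow> 'a" where
  "field_trace F t =
     (\<Oplus>\<^bsub>F\<^esub>j\<in>{..<field_degree F}. t [^]\<^bsub>F\<^esub> (field_prime F ^ j))"

text \<open>The residue in \<open>{0..<p0}\<close> representing an element of the prime subfield.\<close>

definition prime_subfield_rep :: "('a, 'm) ring_scheme \<Rightarrow> 'a \<Rightarrow> nat" where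
  "prime_subfield_rep F a = (THE m. m < field_prime F \<and> [m] \<cdot>\<^bsub>F\<^esub> \<one>\<^bsub>F\<^esub> = a)"

definition add_char :: "('a, 'm) ring_scheme \<Rightarrow> 'a \<Rightarrow> complex" where
  "add_char F t =
     exp (2 * complex_of_real pi * \<i> * of_nat (prime_subfield_rep F (field_trace F t))
          / of_nat (field_prime F))"

definition minus_one_is_square :: "('a, 'm) ring_scheme \<Rightarrow> bool" where
  "minus_one_is_square F \<longleftrightarrow> (\<exists>a\<in>carrier F. a \<otimes>\<^bsub>F\<^esub> a = \<ominus>\<^bsub>F\<^esub> \<one>\<^bsub>F\<^esub>)"


section \<open>The cone and its extension operator\<close>

text \<open>Coordinates are indexed by \<open>{1..n}\<close>. The same set models \<open>F\<^sup>n\<close> and its dual space;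
  only the measures placed on them differ.\<close>

definition vec_space :: "('a, 'm) ring_scheme \<Rightarrow> nat \<Rightarrow> (nat \<Rightarrow> 'a) set" where
  "vec_space F n = ({1..n} \<rightarrow>\<^sub>E carrier F)"

definition dot :: "('a, 'm) ring_scheme \<Rightarrow> nat \<Rightarrow> (nat \<Rightarrow> 'a) \<Rightarrow> (nat \<Rightarrow> 'a) \<Rightarrow> 'a" where
  "dot F n x \<xi> = (\<Oplus>\<^bsub>F\<^esub>i\<in>{1..n}. x i \<otimes>\<^bsub>F\<^esub> \<xi> i)"

definition quad_cone :: "('a, 'm) ring_scheme \<Rightarrow> nat \<Rightarrow> (nat \<Rightarrow> 'a) set" where
  "quad_cone F n = {\<xi> \<in> vec_space F n.
     \<xi> (n - 1) \<otimes>\<^bsub>F\<^esub> \<xi> n = (\<Oplus>\<^bsub>F\<^esub>i\<in>{1..n - 2}. \<xi> i \<otimes>\<^bsub>F\<^esub> \<xi> i)}"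

definition cone_ext ::
    "('a, 'm) ring_scheme \<Rightarrow> nat \<Rightarrow> ((nat \<Rightarrow> 'a) \<Rightarrow> complex) \<Rightarrow> (nat \<Rightarrow> 'a) \<Rightarrow> complex" where
  "cone_ext F n f x =
     1 / of_nat (card (quad_cone F n)) * (\<Sum>\<xi>\<in>quad_cone F n. f \<xi> * add_char F (dot F n x \<xi>))"

text \<open>The \<open>L\<^sup>p\<close> norm for the measure giving mass \<open>w\<close> to every point of the finite set \<open>S\<close>;
  it only depends on the values of \<open>f\<close> on \<open>S\<close>.\<close>

definition Lp_norm :: "real \<Rightarrow> 'b set \<Rightarrow> ennreal \<Rightarrow> ('b \<Rightarrow> complex) \<Rightarrow> real" where
  "Lp_norm w S p f =
     (if p = \<infinity> then Max ((\<lambda>x. norm (f x)) ` S)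
      else (w * (\<Sum>x\<in>S. norm (f x) powr enn2real p)) powr (1 / enn2real p))"

definition cone_norm ::
    "('a, 'm) ring_scheme \<Rightarrow> nat \<Rightarrow> ennreal \<Rightarrow> ((nat \<Rightarrow> 'a) \<Rightarrow> complex) \<Rightarrow> real" where
  "cone_norm F n p f = Lp_norm (1 / real (card (quad_cone F n))) (quad_cone F n) p f"

definition space_norm ::
    "('a, 'm) ring_scheme \<Rightarrow> nat \<Rightarrow> ennreal \<Rightarrow> ((nat \<Rightarrow> 'a) \<Rightarrow> complex) \<Rightarrow> real" where
  "space_norm F n r h = Lp_norm 1 (vec_space F n) r h"

definition extension_constants ::
    "('a, 'm) ring_scheme \<Rightarrow> nat \<Rightarrow> ennreal \<Rightarrow> ennreal \<Rightarrow> real set" where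
  "extension_constants F n p r =
     {C. 0 \<le> C \<and> (\<forall>f. space_norm F n r (cone_ext F n f) \<le> C * cone_norm F n p f)}"

definition R_star :: "('a, 'm) ring_scheme \<Rightarrow> nat \<Rightarrow> ennreal \<Rightarrow> ennreal \<Rightarrow> real" where
  "R_star F n p r = Inf (extension_constants F n p r)"

lemma vec_space_finite: "finite (carrier F) \<Longrightarrow> finite (vec_space F n)"
  unfolding vec_space_def by (auto intro: finite_PiE)

lemma finite_cone: "finite (carrier F) \<Longrightarrow> finite (quad_cone F n)"
  unfolding quad_cone_def by (rule finite_subset[OF _ vec_space_finite]) auto

lemma cone_nonempty:
  assumes "field F" "n \<ge> 3" shows "quad_cone F n \<noteq> {}"
proof -
  interpret field F by fact
  have "(\<lambda>i\<in>{1..n}. \<zero>\<^bsub>F\<^esub>) \<in> quad_cone F n"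
  proof -
    have "(\<Oplus>\<^bsub>F\<^esub>i\<in>{1..n - 2}. (\<lambda>i\<in>{1..n}. \<zero>\<^bsub>F\<^esub>) i \<otimes>\<^bsub>F\<^esub> (\<lambda>i\<in>{1..n}. \<zero>\<^bsub>F\<^esub>) i) = \<zero>\<^bsub>F\<^esub>"
      by (rule add.finprod_one_eqI) auto
    with assms(2) show ?thesis by (auto simp: quad_cone_def vec_space_def)
  qed
  then show ?thesis by blast
qed

lemma Lp_norm_nonneg:
  assumes "finite S" "S \<noteq> {}" shows "0 \<le> Lp_norm w S p f"
  using assms by (auto simp: Lp_norm_def Max_ge_iff ex_in_conv)

lemma point_le_Lp_norm:
  assumes "finite S" "w > 0" "p \<ge> 1" "x \<in> S"
  shows "norm (f x) \<le> (1 / w) powr (1 / enn2real p) * Lp_norm w S p f"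
proof (cases "p = \<infinity>")
  case True
  then show ?thesis using assms by (auto simp: Lp_norm_def)
next
  case False
  define s where "s = enn2real p"
  have s: "s > 0" using False assms(3) unfolding s_def
    by (metis enn2real_positive_iff infinity_ennreal_def less_top not_one_le_zero zero_less_iff_neq_zero)
  have "norm (f x) powr s \<le> (\<Sum>x\<in>S. norm (f x) powr s)"
    using assms by (intro member_le_sum) auto
  then have "(norm (f x) powr s) powr (1/s) \<le> (\<Sum>x\<in>S. norm (f x) powr s) powr (1/s)"
    using s by (intro powr_mono2) auto
  also have "\<dots> = (1 / w) powr (1/s) * (w * (\<Sum>x\<in>S. norm (f x) powr s)) powr (1/s)"
    using assms s by (subst powr_mult[symmetric]) (auto intro!: sum_nonneg)
  finally show ?thesis using False s by (simp add: Lp_norm_def s_def[symmetric] powr_powr)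
qed

lemma Lp_norm_le_sup:
  assumes "finite S" "S \<noteq> {}" "p \<ge> 1" "\<And>x. x \<in> S \<Longrightarrow> norm (f x) \<le> M" "M \<ge> 0"
  shows "Lp_norm 1 S p f \<le> real (card S) powr (1 / enn2real p) * M"
proof (cases "p = \<infinity>")
  case True
  then show ?thesis using assms by (auto simp: Lp_norm_def)
next
  case False
  define s where "s = enn2real p"
  have s: "s > 0" using False assms(3) unfolding s_def
    by (metis enn2real_positive_iff infinity_ennreal_def less_top not_one_le_zero zero_less_iff_neq_zero)
  have "(\<Sum>x\<in>S. norm (f x) powr s) \<le> (\<Sum>x\<in>S. M powr s)"
    using assms s by (intro sum_mono powr_mono2) auto
  then have "(\<Sum>x\<in>S. norm (f x) powr s) powr (1/s) \<le> (real (card S) * M powr s) powr (1/s)"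
    using s by (intro powr_mono2) (auto intro!: sum_nonneg)
  also have "\<dots> = real (card S) powr (1/s) * M"
    using s assms by (simp add: powr_mult powr_powr)
  finally show ?thesis using False by (simp add: Lp_norm_def s_def[symmetric])
qed

lemma norm_add_char: "norm (add_char F t) = 1"
proof -
  have "add_char F t = exp (\<i> * of_real (2 * pi * real (prime_subfield_rep F (field_trace F t)) / real (field_prime F)))"
    by (simp add: add_char_def mult_ac)
  then show ?thesis by (simp only: norm_exp_i_times)
qed

text \<open>The infimum defining \<open>R_star\<close> is a minimum.\<close>

lemma R_star_best:
  assumes F: "odd_finite_field F" and n: "n \<ge> 3" and p: "1 \<le> p" and r: "1 \<le> r"
  shows "R_star F n p r \<in> extension_constants F n p r"
    and "C \<in> extension_constants F n p r \<Longrightarrow> R_star F n p r \<le> C"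
proof -
  let ?E = "extension_constants F n p r" and ?S = "quad_cone F n" and ?X = "vec_space F n"
  have fin: "finite (carrier F)" "field F" using F by (auto simp: odd_finite_field_def)
  have S: "finite ?S" "?S \<noteq> {}" using finite_cone fin cone_nonempty n by blast+
  have X: "finite ?X" "?X \<noteq> {}" using vec_space_finite fin S(2) by (auto simp: quad_cone_def)
  define w where "w = 1 / real (card ?S)"
  have w: "w > 0" using S by (simp add: w_def card_gt_0_iff)
  define K where "K = (1 / w) powr (1 / enn2real p)"
  have "real (card ?X) powr (1 / enn2real r) * K \<in> ?E"
    unfolding extension_constants_def
  proof (intro CollectI conjI allI)
    show "0 \<le> real (card ?X) powr (1 / enn2real r) * K" by (simp add: K_def)
    fix f
    let ?M = "K * cone_norm F n p f"
    have M0: "?M \<ge> 0" using Lp_norm_nonneg[OF S] by (simp add: K_def cone_norm_def)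
    have "norm (cone_ext F n f x) \<le> ?M" for x
    proof -
      have "norm (\<Sum>\<xi>\<in>?S. f \<xi> * add_char F (dot F n x \<xi>)) \<le> (\<Sum>\<xi>\<in>?S. ?M)"
        using point_le_Lp_norm[OF S(1) w p]
        by (intro sum_norm_le) (auto simp: norm_mult norm_add_char K_def cone_norm_def w_def)
      then show ?thesis using w S
        by (simp add: cone_ext_def norm_mult norm_divide w_def field_simps)
    qed
    then show "space_norm F n r (cone_ext F n f)
        \<le> real (card ?X) powr (1 / enn2real r) * K * cone_norm F n p f"
      using Lp_norm_le_sup[OF X r _ M0] by (simp add: space_norm_def mult.assoc)
  qed
  then have ne: "?E \<noteq> {}" by blast
  have bdd: "bdd_below ?E" by (rule bdd_belowI[of _ 0]) (simp add: extension_constants_def)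
  show "C \<in> ?E \<Longrightarrow> R_star F n p r \<le> C"
    unfolding R_star_def using bdd by (rule cInf_lower[rotated])
  show "R_star F n p r \<in> ?E"
    unfolding extension_constants_def
  proof (intro CollectI conjI allI)
    show "0 \<le> R_star F n p r"
      unfolding R_star_def using ne by (rule cInf_greatest) (simp add: extension_constants_def)
    fix f
    have nn: "cone_norm F n p f \<ge> 0" using Lp_norm_nonneg[OF S] by (simp add: cone_norm_def)
    obtain C0 where C0: "C0 \<in> ?E" using ne by blast
    show "space_norm F n r (cone_ext F n f) \<le> R_star F n p r * cone_norm F n p f"
    proof (cases "cone_norm F n p f = 0")
      case True
      then show ?thesis using C0 by (auto simp: extension_constants_def dest!: spec[of _ f])
    next
      case False
      with nn have pos: "cone_norm F n p f > 0" by simp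
      have "space_norm F n r (cone_ext F n f) / cone_norm F n p f \<le> R_star F n p r"
        unfolding R_star_def using ne
        by (rule cInf_greatest) (use pos in \<open>auto simp: extension_constants_def pos_divide_le_eq\<close>)
      then show ?thesis using pos by (simp add: pos_divide_le_eq)
    qed
  qed
qed

text \<open>\<open>R_star\<close> is bounded uniformly over all finite fields of odd characteristic with
  property \<open>P\<close>. Every finite field has an isomorphic copy whose carrier is a set of integers,
  and \<open>R_star\<close> is invariant under isomorphism, so ranging over rings on the type \<open>int\<close>
  covers all finite fields.\<close>

definition R_star_bounded :: "nat \<Rightarrow> ennreal \<Rightarrow> ennreal \<Rightarrow> (int ring \<Rightarrow> bool) \<Rightarrow> bool" where
  "R_star_bounded n p r P \<longleftrightarrow>
     (\<exists>C::real. \<forall>F :: int ring. odd_finite_field F \<and> P F \<longrightarrow> R_star F n p r \<le> C)"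

end

theory Submission
  imports Defs "HOL-Number_Theory.Residues" "HOL-Real_Asymp.Real_Asymp"
begin

text \<open>It suffices to test the extension inequality over fields of prime order \<open>q\<close>, letting \<open>q \<rightarrow> \<infinity>\<close>.

  Take first a function of modulus one on \<open>\<xi>\<^sub>n \<noteq> 0\<close> that depends on \<open>\<xi>\<^sub>n\<close> only, chosen so as to cancel
  the phases of the Gauss sums that come from the summation over \<open>\<xi>\<^sub>1, \<dots>, \<xi>\<^bsub>n - 2\<^esub>\<close>. Its extension
  has size about \<open>q\<^bsup>- (n - 2) / 2\<^esup>\<close> at about \<open>q\<^bsup>n - 1\<^esup>\<close> points of the dual cone, which forces
  \<open>1 / r \<le> (n - 2) / (2 n - 2)\<close>.

  Take next the indicator of an isotropic subspace of dimension \<open>k\<close>, whose extension is constant on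
  the annihilator. This forces \<open>(n - k) / r \<le> (n - 1 - k) (1 - 1 / p)\<close>. If \<open>- 1\<close> is a square one can
  take \<open>k = \<lfloor>n / 2\<rfloor>\<close>. If it is not and \<open>4\<close> divides \<open>n\<close>, one can take \<open>k = (n - 2) / 2\<close>; there it is
  convenient to use only the primes for which \<open>- 2\<close> is a square. Both families of primes are
  infinite, by Euclid's argument applied to \<open>M\<^sup>2 + 1\<close> and \<open>M\<^sup>2 + 2\<close>.\<close>

section \<open>Characters and Gauss sums modulo a prime\<close>

text \<open>Taken on all of \<open>int\<close> instead of on residues: exponents are then computed
  with integer arithmetic and reduced only through \<open>unit_char_cong\<close>.\<close>

definition unit_char :: "nat \<Rightarrow> int \<Rightarrow> complex" where
  "unit_char p k = cis (2 * pi * of_int k / of_nat p)"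

lemma unit_char_add: "unit_char p (a + b) = unit_char p a * unit_char p b"
  by (simp add: unit_char_def cis_mult ring_distribs add_divide_distrib)

lemma unit_char_0 [simp]: "unit_char p 0 = 1"
  by (simp add: unit_char_def)

lemma norm_unit_char [simp]: "norm (unit_char p k) = 1"
  by (simp add: unit_char_def)

lemma cnj_unit_char: "cnj (unit_char p k) = unit_char p (- k)"
  by (simp add: unit_char_def cis_cnj)

lemma unit_char_sum: "unit_char p (sum f I) = (\<Prod>i\<in>I. unit_char p (f i))"
  by (induction I rule: infinite_finite_induct) (auto simp: unit_char_add)

lemma unit_char_eq_1_iff:
  assumes "p > 0"
  shows "unit_char p k = 1 \<longleftrightarrow> int p dvd k"
proof
  assume "unit_char p k = 1"
  then have "cos (2 * pi * of_int k / of_nat p) = 1"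
    by (metis unit_char_def cis.sel(1) one_complex.sel(1))
  then obtain m :: int where "2 * pi * of_int k / of_nat p = of_int m * 2 * pi"
    by (auto simp: cos_one_2pi_int)
  then have "real_of_int k = of_int (m * int p)"
    using assms by (simp add: field_simps)
  then show "int p dvd k" by (simp only: of_int_eq_iff) simp
next
  assume "int p dvd k"
  then obtain m where "k = int p * m" by auto
  then have "unit_char p k = cis (2 * pi * of_int m)"
    using assms by (simp add: unit_char_def mult.assoc[symmetric] del: cis_multiple_2pi)
  then show "unit_char p k = 1" by (simp only: cis_multiple_2pi Ints_of_int)
qed

lemma unit_char_cong:
  assumes "p > 0" "[a = b] (mod int p)"
  shows "unit_char p a = unit_char p b"
proof -
  have "unit_char p (a - b) = 1"
    using assms by (simp add: unit_char_eq_1_iff cong_iff_dvd_diff)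
  then show ?thesis using unit_char_add[of p "a - b" b] by simp
qed

text \<open>For \<open>a\<close> coprime to \<open>m\<close>, the map sending \<open>u\<close> to
  \<open>(a * u + b) mod m\<close> is injective on a finite set, hence permutes the residues. This
  change of variables gives both the orthogonality of characters and the completion of
  squares.\<close>

lemma sum_residues_affine:
  fixes h :: "int \<Rightarrow> 'a::comm_monoid_add" and m :: int
  assumes "m > 0" "coprime a m" and per: "\<And>u v. [u = v] (mod m) \<Longrightarrow> h u = h v"
  shows "(\<Sum>u\<in>{0..<m}. h (a * u + b)) = (\<Sum>u\<in>{0..<m}. h u)"
proof -
  have inj: "inj_on (\<lambda>u. (a * u + b) mod m) {0..<m}"
  proof (rule inj_onI)
    fix u v assume uv: "u \<in> {0..<m}" "v \<in> {0..<m}" "(a * u + b) mod m = (a * v + b) mod m"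
    then have "[a * u + b = a * v + b] (mod m)" by (simp add: cong_def)
    then have "[u = v] (mod m)"
      using assms(2) by (simp add: cong_add_rcancel cong_mult_lcancel)
    then show "u = v" using uv by (simp add: cong_def)
  qed
  have "(\<lambda>u. (a * u + b) mod m) ` {0..<m} \<subseteq> {0..<m}" using assms(1) by auto
  then have "bij_betw (\<lambda>u. (a * u + b) mod m) {0..<m} {0..<m}"
    using inj by (simp add: bij_betw_def endo_inj_surj)
  then have "(\<Sum>u\<in>{0..<m}. h ((a * u + b) mod m)) = (\<Sum>u\<in>{0..<m}. h u)"
    by (rule sum.reindex_bij_betw)
  moreover have "h ((a * u + b) mod m) = h (a * u + b)" for u
    by (rule per) simp
  ultimately show ?thesis by simp
qed

lemma sum_unit_char:
  assumes "p > 0"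
  shows "(\<Sum>v\<in>{0..<int p}. unit_char p (k * v)) = (if int p dvd k then of_nat p else 0)"
proof (cases "int p dvd k")
  case True
  then have "unit_char p (k * v) = 1" for v using assms by (simp add: unit_char_eq_1_iff)
  then show ?thesis using True by simp
next
  case False
  \<comment> \<open>The shift \<open>v + 1\<close> permutes the residues and multiplies the sum by
    \<open>unit_char p k\<close>, which is not 1, so the sum vanishes.\<close>
  have "(\<Sum>v\<in>{0..<int p}. unit_char p (k * v)) = (\<Sum>v\<in>{0..<int p}. unit_char p (k * (1 * v + 1)))"
    using assms by (intro sum_residues_affine[symmetric, where h = "\<lambda>v. unit_char p (k * v)"])
      (auto intro: unit_char_cong cong_scalar_left)
  also have "\<dots> = (\<Sum>v\<in>{0..<int p}. unit_char p (k * v)) * unit_char p k"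
    by (simp add: ring_distribs unit_char_add sum_distrib_right)
  finally show ?thesis using False assms
    by (simp add: unit_char_eq_1_iff)
qed

definition gauss_sum :: "nat \<Rightarrow> int \<Rightarrow> complex" where
  "gauss_sum p a = (\<Sum>u\<in>{0..<int p}. unit_char p (a * u\<^sup>2))"

text \<open>The squared modulus is a double sum over \<open>u\<close> and \<open>v\<close>; after
  \<open>u = w + v\<close> the sum over \<open>v\<close> is a character sum with frequency
  \<open>2 * a * w\<close>. Since \<open>2 * a\<close> is invertible, only \<open>w = 0\<close>
  survives and contributes \<open>p\<close>.\<close>

lemma gauss_sum_norm:
  assumes "odd p" "coprime a (int p)"
  shows "(norm (gauss_sum p a))\<^sup>2 = real p"
proof -
  have p: "p > 0" using assms(1) by (rule odd_pos)
  have c: "int p dvd 2 * a * w \<longleftrightarrow> int p dvd w" for w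
  proof -
    have "coprime (int p) (2 * a)" using assms by (simp add: coprime_commute)
    then show ?thesis by (rule coprime_dvd_mult_right_iff)
  qed
  have "gauss_sum p a * cnj (gauss_sum p a)
      = (\<Sum>v\<in>{0..<int p}. \<Sum>u\<in>{0..<int p}. unit_char p (a * (u\<^sup>2 - v\<^sup>2)))"
    unfolding gauss_sum_def cnj_sum sum_product
    by (subst sum.swap) (simp add: cnj_unit_char unit_char_add[symmetric] right_diff_distrib)
  also have "\<dots> = (\<Sum>v\<in>{0..<int p}. \<Sum>w\<in>{0..<int p}. unit_char p (a * ((1 * w + v)\<^sup>2 - v\<^sup>2)))"
    using p by (intro sum.cong refl sum_residues_affine[symmetric,
        where h = "\<lambda>u. unit_char p (a * (u\<^sup>2 - _\<^sup>2))"])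
      (auto intro!: unit_char_cong cong_scalar_left cong_diff cong_pow)
  also have "\<dots> = (\<Sum>w\<in>{0..<int p}. unit_char p (a * w\<^sup>2) *
                     (\<Sum>v\<in>{0..<int p}. unit_char p (2 * a * w * v)))"
    unfolding sum_distrib_left
    by (subst sum.swap) (simp add: unit_char_add[symmetric] algebra_simps power2_eq_square)
  also have "\<dots> = (\<Sum>w\<in>{0..<int p}. if w = 0 then of_nat p else 0)"
    using p by (intro sum.cong refl) (use zdvd_not_zless in \<open>force simp: sum_unit_char c\<close>)
  also have "\<dots> = of_nat p" using p by simp
  finally have "gauss_sum p a * cnj (gauss_sum p a) = of_nat p" .
  then have "complex_of_real ((norm (gauss_sum p a))\<^sup>2) = of_real (real p)"
    by (simp only: complex_norm_square of_real_of_nat_eq)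
  then show ?thesis by (simp only: of_real_eq_iff)
qed

text \<open>Completing the square: as \<open>t * t' = 1\<close>, the exponent is
  \<open>t' * (c * u + t * y)^2 - t * y^2\<close> modulo \<open>p\<close>, and
  \<open>c * u + t * y\<close> runs through all residues. Since the leading coefficient carries the
  square \<open>c^2\<close>, the Gauss sum does not involve \<open>c\<close>.\<close>

lemma sum_unit_char_quadratic:
  assumes "p > 0" "coprime c (int p)" "[t * t' = 1] (mod int p)"
  shows "(\<Sum>u\<in>{0..<int p}. unit_char p (c\<^sup>2 * t' * u\<^sup>2 + 2 * c * y * u))
           = unit_char p (- t * y\<^sup>2) * gauss_sum p t'"
proof -
  have "gauss_sum p t' = (\<Sum>u\<in>{0..<int p}. unit_char p (t' * (c * u + t * y)\<^sup>2))"
    unfolding gauss_sum_def using assms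
    by (intro sum_residues_affine[symmetric, where h = "\<lambda>u. unit_char p (t' * u\<^sup>2)"])
      (auto intro!: unit_char_cong cong_scalar_left cong_pow)
  moreover have "unit_char p (c\<^sup>2 * t' * u\<^sup>2 + 2 * c * y * u)
      = unit_char p (- t * y\<^sup>2) * unit_char p (t' * (c * u + t * y)\<^sup>2)" for u
  proof -
    have "- t * y\<^sup>2 + t' * (c * u + t * y)\<^sup>2 - (c\<^sup>2 * t' * u\<^sup>2 + 2 * c * y * u)
        = (t * t' - 1) * (2 * c * u * y + t * y\<^sup>2)" by (simp add: power2_eq_square algebra_simps)
    moreover have "int p dvd t * t' - 1" using assms(3) by (simp add: cong_iff_dvd_diff)
    ultimately have "[- t * y\<^sup>2 + t' * (c * u + t * y)\<^sup>2 = c\<^sup>2 * t' * u\<^sup>2 + 2 * c * y * u] (mod int p)"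
      by (simp add: cong_iff_dvd_diff)
    from unit_char_cong[OF assms(1) this] show ?thesis by (simp only: unit_char_add)
  qed
  ultimately show ?thesis by (simp add: sum_distrib_left)
qed

section \<open>The extension operator over prime fields\<close>

text \<open>The theorem forms \<open>1 / s\<close> in \<open>ennreal\<close>, whereas
  \<open>Lp_norm\<close> divides in \<open>real\<close>. The two agree for finite \<open>s\<close>;
  at infinity the former is 0.\<close>

lemma enn2real_one_divide:
  fixes s :: ennreal
  assumes "1 \<le> s"
  shows "enn2real (1 / s) = (if s = \<infinity> then 0 else 1 / enn2real s)"
    and "s \<noteq> \<infinity> \<Longrightarrow> 1 \<le> enn2real s"
    and "0 \<le> enn2real (1 / s)" "enn2real (1 / s) \<le> 1"
proof -
  have *: "enn2real (1 / s) = 1 / enn2real s \<and> 1 \<le> enn2real s" if fin: "s \<noteq> \<infinity>"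
  proof -
    obtain a where a: "s = ennreal a" "0 \<le> a" using fin by (cases s) (auto simp: infinity_ennreal_def)
    then have "1 \<le> a" using assms by (simp flip: ennreal_1)
    moreover have "1 / ennreal a = ennreal (1 / a)"
      using \<open>1 \<le> a\<close> divide_ennreal[of 1 a] by simp
    ultimately show ?thesis using a by simp
  qed
  then show "enn2real (1 / s) = (if s = \<infinity> then 0 else 1 / enn2real s)"
    and "s \<noteq> \<infinity> \<Longrightarrow> 1 \<le> enn2real s" by auto
  show "0 \<le> enn2real (1 / s)" "enn2real (1 / s) \<le> 1"
    using * by (cases "s = \<infinity>"; auto)+
qed

lemma Lp_norm_ge:
  assumes "finite S" "B \<subseteq> S" "1 \<le> s" "s \<noteq> \<infinity>" "0 \<le> M" "\<And>x. x \<in> B \<Longrightarrow> M \<le> norm (h x)"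
  shows "real (card B) powr enn2real (1 / s) * M \<le> Lp_norm 1 S s h"
proof -
  define a where "a = enn2real s"
  have a: "1 \<le> a" using enn2real_one_divide(2)[of s] assms by (simp add: a_def)
  have "real (card B) powr enn2real (1 / s) * M = (\<Sum>x\<in>B. M powr a) powr (1 / a)"
    using a assms by (simp add: enn2real_one_divide(1) powr_mult powr_powr flip: a_def)
  also have "\<dots> \<le> (\<Sum>x\<in>S. norm (h x) powr a) powr (1 / a)"
  proof (intro powr_mono2)
    have "(\<Sum>x\<in>B. M powr a) \<le> (\<Sum>x\<in>B. norm (h x) powr a)"
      using assms a by (intro sum_mono powr_mono2) auto
    also have "\<dots> \<le> (\<Sum>x\<in>S. norm (h x) powr a)"
      using assms by (intro sum_mono2) auto
    finally show "(\<Sum>x\<in>B. M powr a) \<le> (\<Sum>x\<in>S. norm (h x) powr a)" .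
  qed (use a in \<open>auto intro: sum_nonneg\<close>)
  finally show ?thesis using assms by (simp add: Lp_norm_def a_def)
qed

lemma Lp_norm_average_le:
  assumes "finite S" "A \<subseteq> S" "A \<noteq> {}" "1 \<le> s"
    and "\<And>x. x \<in> A \<Longrightarrow> norm (f x) \<le> 1" "\<And>x. x \<in> S - A \<Longrightarrow> f x = 0"
  shows "Lp_norm (1 / real (card S)) S s f \<le> (real (card A) / real (card S)) powr enn2real (1 / s)"
proof (cases "s = \<infinity>")
  case True
  \<comment> \<open>For \<open>s = \<infinity>\<close> the right-hand side has exponent 0. Its base
    must be nonzero for the value to be 1, since \<open>0 powr 0 = 0\<close>.\<close>
  have "card A > 0" "card S > 0" using assms by (auto simp: card_gt_0_iff dest: finite_subset)
  moreover have "Max ((\<lambda>x. norm (f x)) ` S) \<le> 1"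
    using assms by (subst Max_le_iff) (auto, metis Diff_iff norm_zero zero_le_one)
  ultimately show ?thesis using True by (simp add: Lp_norm_def)
next
  case False
  define a where "a = enn2real s"
  have a: "1 \<le> a" using enn2real_one_divide(2)[of s] assms False by (simp add: a_def)
  have "(\<Sum>x\<in>S. norm (f x) powr a) = (\<Sum>x\<in>A. norm (f x) powr a)"
    using assms by (intro sum.mono_neutral_right) auto
  also have "\<dots> \<le> (\<Sum>x\<in>A. 1)"
    using a assms by (intro sum_mono powr_le1) auto
  finally have "(1 / real (card S) * (\<Sum>x\<in>S. norm (f x) powr a)) powr (1 / a)
      \<le> (real (card A) / real (card S)) powr (1 / a)"
    using a by (intro powr_mono2) (auto intro!: divide_right_mono divide_nonneg_nonneg sum_nonneg)
  then show ?thesis using False assms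
    by (simp add: Lp_norm_def enn2real_one_divide(1) a_def)
qed

text \<open>Together with \<open>sum_quadruples\<close>, this cuts the coordinates into the blocks
  on which the isotropic vectors are supported.\<close>

lemma sum_pairs:
  fixes g :: "nat \<Rightarrow> 'b::comm_monoid_add"
  shows "(\<Sum>i\<in>{1..2 * m}. g i) = (\<Sum>j<m. g (2 * j + 1) + g (2 * j + 2))"
  by (induction m) (auto simp: add_ac)

lemma sum_quadruples:
  fixes g :: "nat \<Rightarrow> 'b::comm_monoid_add"
  shows "(\<Sum>i\<in>{1..4 * m}. g i) = (\<Sum>j<m. g (4 * j + 1) + g (4 * j + 2) + g (4 * j + 3) + g (4 * j + 4))"
  by (induction m) (auto simp: add_ac numeral_eq_Suc)

section \<open>Residue rings modulo an odd prime as concrete finite fields\<close>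

locale odd_prime_field = residues_prime +
  assumes p_odd: "odd p"
begin

lemma p_pos: "p > 0"
  using p_prime by (rule prime_gt_0_nat)

lemma carrier_eq: "carrier R = {0..<int p}"
  by (auto simp: res_carrier_eq)

lemma odd_finite_field: "odd_finite_field R"
proof -
  have "card (carrier R) = p ^ 1" by (simp add: carrier_eq)
  then show ?thesis
    unfolding odd_finite_field_def using is_field p_prime p_odd by blast
qed

lemma field_prime_eq: "field_prime R = p"
  unfolding field_prime_def
proof (rule the_equality)
  show "prime p \<and> (\<exists>l. card (carrier R) = p ^ l)"
    using p_prime by (auto simp: carrier_eq intro!: exI[of _ 1])
next
  fix q assume "prime q \<and> (\<exists>l. card (carrier R) = q ^ l)"
  then obtain l where "prime q" "p = q ^ l" by (auto simp: carrier_eq)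
  then show "q = p" using p_prime by (simp add: prime_power_iff)
qed

lemma field_degree_eq: "field_degree R = 1"
  unfolding field_degree_def field_prime_eq
proof (rule the_equality)
  fix l assume "card (carrier R) = p ^ l"
  then have "p ^ 1 = p ^ l" by (simp add: carrier_eq)
  then show "l = 1" using p_prime prime_gt_1_nat[of p] by (simp only: power_inject_exp)
qed (simp add: carrier_eq)

text \<open>In degree one the trace has the single summand \<open>t\<close>, and \<open>m\<close>
  copies of \<open>\<one>\<close> add up to \<open>m mod p\<close>, so the representative of a
  residue is the residue itself.\<close>

lemma add_char_eq:
  assumes "t \<in> carrier R"
  shows "add_char R t = unit_char p t"
proof -
  have "field_trace R t = t"
    using assms by (simp add: field_trace_def field_degree_eq lessThan_Suc)
  moreover have "prime_subfield_rep R t = nat t"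
  proof -
    have m: "[m] \<cdot> \<one> = int m mod int p" for m :: nat
    proof (induction m)
      case (Suc m)
      then show ?case by (simp add: add.nat_pow_Suc res_add_eq res_one_eq mod_simps add.commute)
    qed (simp add: res_zero_eq)
    show ?thesis unfolding prime_subfield_rep_def field_prime_eq m
      by (rule the_equality) (use assms in \<open>auto simp: carrier_eq\<close>)
  qed
  ultimately show ?thesis using assms
    by (simp add: add_char_def unit_char_def field_prime_eq cis_conv_exp carrier_eq mult_ac)
qed

lemma add_char_dot: "add_char R (dot R n x \<xi>) = unit_char p (\<Sum>i\<in>{1..n}. x i * \<xi> i)"
proof -
  have d: "dot R n x \<xi> = (\<Sum>i\<in>{1..n}. x i * \<xi> i) mod int p"
    by (simp add: dot_def res_mult_eq sum_cong)
  have "add_char R (dot R n x \<xi>) = unit_char p (dot R n x \<xi>)"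
    by (rule add_char_eq) (simp add: d)
  also have "\<dots> = unit_char p (\<Sum>i\<in>{1..n}. x i * \<xi> i)"
    by (rule unit_char_cong) (auto simp: d p_pos)
  finally show ?thesis .
qed

lemma vec_space_eq: "vec_space R n = {1..n} \<rightarrow>\<^sub>E {0..<int p}"
  by (simp add: vec_space_def carrier_eq)

lemma quad_cone_eq: "quad_cone R n =
    {\<xi> \<in> vec_space R n. [\<xi> (n - 1) * \<xi> n = (\<Sum>i\<in>{1..n - 2}. (\<xi> i)\<^sup>2)] (mod int p)}"
  by (auto simp: quad_cone_def res_mult_eq sum_cong cong_def power2_eq_square)

lemma finite_vec_space [simp]: "finite (vec_space R n)"
  by (rule vec_space_finite) simp

lemma finite_quad_cone [simp]: "finite (quad_cone R n)"
  by (rule finite_cone) simp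

lemma cong_residue_eq:
  assumes "a \<in> {0..<int p}" "b \<in> {0..<int p}" "[a = b] (mod int p)"
  shows "a = b"
  using assms by (simp add: cong_def)

lemma coprime_p_iff: "a \<in> {0..<int p} \<Longrightarrow> coprime a (int p) \<longleftrightarrow> a \<noteq> 0"
  using zdvd_not_zless[of a "int p"] by (force simp: p_coprime_right_int)

text \<open>A point is determined by all coordinates but one: the last vanishes, or it determines
  the second to last.\<close>

lemma card_quad_cone_le:
  assumes "n \<ge> 3"
  shows "card (quad_cone R n) \<le> 2 * p ^ (n - 1)"
proof -
  define C0 where "C0 = {\<xi> \<in> quad_cone R n. \<xi> n = 0}"
  define C1 where "C1 = {\<xi> \<in> quad_cone R n. \<xi> n \<noteq> 0}"
  have bound: "card D \<le> p ^ (n - 1)"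
    if k: "k \<in> {1..n}" and D: "D \<subseteq> vec_space R n"
      and inj: "\<And>\<xi> \<eta>. \<lbrakk>\<xi> \<in> D; \<eta> \<in> D; \<And>i. i \<in> {1..n} - {k} \<Longrightarrow> \<xi> i = \<eta> i\<rbrakk> \<Longrightarrow> \<xi> k = \<eta> k" for D k
  proof -
    have "card D \<le> card (({1..n} - {k}) \<rightarrow>\<^sub>E {0..<int p})"
    proof (rule card_inj_on_le)
      show "inj_on (\<lambda>\<xi>. restrict \<xi> ({1..n} - {k})) D"
      proof (rule inj_onI)
        fix \<xi> \<eta> assume h: "\<xi> \<in> D" "\<eta> \<in> D"
          and eq: "restrict \<xi> ({1..n} - {k}) = restrict \<eta> ({1..n} - {k})"
        have i: "\<xi> i = \<eta> i" if "i \<in> {1..n} - {k}" for i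
          using fun_cong[OF eq, of i] that by simp
        then have "\<xi> k = \<eta> k" by (rule inj[OF h])
        show "\<xi> = \<eta>"
        proof (rule PiE_ext)
          show "\<xi> \<in> {1..n} \<rightarrow>\<^sub>E {0..<int p}" "\<eta> \<in> {1..n} \<rightarrow>\<^sub>E {0..<int p}"
            using h D by (auto simp: vec_space_eq)
        qed (use i \<open>\<xi> k = \<eta> k\<close> in auto)
      qed
      show "(\<lambda>\<xi>. restrict \<xi> ({1..n} - {k})) ` D \<subseteq> ({1..n} - {k}) \<rightarrow>\<^sub>E {0..<int p}"
        using D by (intro image_subsetI) (auto simp: vec_space_eq restrict_PiE_iff PiE_iff)
    qed (auto intro: finite_PiE)
    also have "\<dots> = p ^ (n - 1)" using k by (simp add: card_PiE)
    finally show ?thesis .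
  qed
  have "card C0 \<le> p ^ (n - 1)"
    by (rule bound[of n]) (use assms in \<open>auto simp: C0_def quad_cone_eq\<close>)
  moreover have "card C1 \<le> p ^ (n - 1)"
  proof (rule bound[of "n - 1"])
    fix \<xi> \<eta> assume h: "\<xi> \<in> C1" "\<eta> \<in> C1" and eq: "\<And>i. i \<in> {1..n} - {n - 1} \<Longrightarrow> \<xi> i = \<eta> i"
    have "\<xi> n = \<eta> n" using eq assms by auto
    moreover have "(\<Sum>i\<in>{1..n - 2}. (\<xi> i)\<^sup>2) = (\<Sum>i\<in>{1..n - 2}. (\<eta> i)\<^sup>2)"
    proof (intro sum.cong refl)
      fix i assume "i \<in> {1..n - 2}"
      then have "i \<in> {1..n} - {n - 1}" by auto
      then show "(\<xi> i)\<^sup>2 = (\<eta> i)\<^sup>2" by (simp only: eq)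
    qed
    ultimately have "[\<xi> (n - 1) * \<xi> n = \<eta> (n - 1) * \<xi> n] (mod int p)"
      using h by (auto simp: C1_def quad_cone_eq cong_def)
    moreover have r: "\<xi> n \<in> {0..<int p}" "\<xi> (n - 1) \<in> {0..<int p}" "\<eta> (n - 1) \<in> {0..<int p}"
      using h assms by (auto simp: C1_def quad_cone_eq vec_space_eq PiE_iff)
    moreover have "coprime (\<xi> n) (int p)" using r h by (simp add: coprime_p_iff C1_def)
    ultimately have "[\<xi> (n - 1) = \<eta> (n - 1)] (mod int p)" by (simp add: cong_mult_rcancel)
    with r show "\<xi> (n - 1) = \<eta> (n - 1)" by (blast intro: cong_residue_eq)
  qed (use assms in \<open>auto simp: C1_def quad_cone_eq\<close>)
  moreover have "quad_cone R n = C0 \<union> C1" by (auto simp: C0_def C1_def)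
  then have "card (quad_cone R n) \<le> card C0 + card C1" by (simp add: card_Un_le)
  ultimately show ?thesis by simp
qed

lemma R_star_nonneg:
  assumes "n \<ge> 3" "1 \<le> s" "1 \<le> r"
  shows "0 \<le> R_star R n s r"
  using R_star_best(1)[OF odd_finite_field assms] by (simp add: extension_constants_def)

text \<open>Both tests go through this inequality. The function equal to \<open>f\<close> on
  \<open>A\<close> and 0 elsewhere has norm at most \<open>(|A| / |C|) powr (1 / s)\<close>, and its
  extension is at least \<open>M / |C|\<close> on \<open>B\<close>; the factor \<open>|C|\<close> is
  then moved to the right.\<close>

lemma extension_test:
  fixes s r :: ennreal
  assumes n: "n \<ge> 3" and s: "1 \<le> s" and r: "1 \<le> r" "r \<noteq> \<infinity>" and K: "R_star R n s r \<le> K"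
    and A: "A \<subseteq> quad_cone R n" "A \<noteq> {}" and B: "B \<subseteq> vec_space R n" and M: "0 \<le> M"
    and f: "\<And>\<xi>. \<xi> \<in> A \<Longrightarrow> norm (f \<xi>) \<le> 1"
    and large: "\<And>x. x \<in> B \<Longrightarrow> M \<le> norm (\<Sum>\<xi>\<in>A. f \<xi> * unit_char p (\<Sum>i\<in>{1..n}. x i * \<xi> i))"
  shows "real (card B) powr enn2real (1 / r) * M
    \<le> K * (real (card A) / real (card (quad_cone R n))) powr enn2real (1 / s) * real (card (quad_cone R n))"
proof -
  let ?C = "quad_cone R n"
  define g where "g \<xi> = (if \<xi> \<in> A then f \<xi> else 0)" for \<xi>
  have C: "card ?C > 0" using A by (auto simp: card_gt_0_iff)
  have ext: "cone_ext R n g x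
      = (\<Sum>\<xi>\<in>A. f \<xi> * unit_char p (\<Sum>i\<in>{1..n}. x i * \<xi> i)) / of_nat (card ?C)" for x
  proof -
    have "(\<Sum>\<xi>\<in>?C. g \<xi> * add_char R (dot R n x \<xi>))
        = (\<Sum>\<xi>\<in>A. f \<xi> * unit_char p (\<Sum>i\<in>{1..n}. x i * \<xi> i))"
      using A by (intro sum.mono_neutral_cong_right) (auto simp: g_def add_char_dot)
    then show ?thesis by (simp add: cone_ext_def)
  qed
  have "real (card B) powr enn2real (1 / r) * (M / card ?C) \<le> space_norm R n r (cone_ext R n g)"
    unfolding space_norm_def using B r M large
    by (intro Lp_norm_ge) (auto simp: ext norm_divide intro!: divide_right_mono)
  also have "\<dots> \<le> R_star R n s r * cone_norm R n s g"
    using R_star_best(1)[OF odd_finite_field n s r(1)] by (simp add: extension_constants_def)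
  also have "\<dots> \<le> K * (real (card A) / real (card ?C)) powr enn2real (1 / s)"
  proof (rule mult_mono)
    show "cone_norm R n s g \<le> (real (card A) / real (card ?C)) powr enn2real (1 / s)"
      unfolding cone_norm_def using A s f by (intro Lp_norm_average_le) (auto simp: g_def)
    show "0 \<le> cone_norm R n s g"
      unfolding cone_norm_def using A by (intro Lp_norm_nonneg) auto
    show "0 \<le> K" using K R_star_nonneg[OF n s r(1)] by linarith
  qed (fact K)
  finally show ?thesis using C by (simp add: field_simps)
qed

section \<open>The phase-corrected test function on the cone\<close>

lemma residue_inverses:
  obtains v where "\<And>t. t \<in> {1..<int p} \<Longrightarrow> [t * v t = 1] (mod int p)"
proof -
  have "\<exists>u. [t * u = 1] (mod int p)" if "t \<in> {1..<int p}" for t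
    using that by (intro cong_solve_coprime_int) (simp add: coprime_p_iff)
  then obtain v where "\<forall>t\<in>{1..<int p}. [t * v t = 1] (mod int p)" by metis
  then show thesis using that by blast
qed

text \<open>Here \<open>m\<close> is n - 2 and \<open>v\<close> is meant to choose inverses modulo
  \<open>p\<close>. For nonzero \<open>t\<close> the equation of the cone is solved for coordinate n
  - 1, which parametrises the part of the cone with nonzero last coordinate.\<close>

definition cone_point :: "nat \<Rightarrow> (int \<Rightarrow> int) \<Rightarrow> int \<times> (nat \<Rightarrow> int) \<Rightarrow> nat \<Rightarrow> int" where
  "cone_point m v = (\<lambda>(t, \<zeta>). \<lambda>i\<in>{1..m + 2}.
     if i \<le> m then \<zeta> i else if i = m + 1 then (v t * (\<Sum>i\<in>{1..m}. (\<zeta> i)\<^sup>2)) mod int p else t)"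

text \<open>These points satisfy \<open>4 x\<^bsub>n - 1\<^esub> x\<^sub>n = x\<^sub>1\<^sup>2 + \<dots> + x\<^bsub>n - 2\<^esub>\<^sup>2\<close>, and since the coordinate \<open>x\<^bsub>n - 1\<^esub>\<close> is a
  square, the Gauss sums in the extension do not depend on them.\<close>

definition dual_cone_point :: "nat \<Rightarrow> int \<times> (nat \<Rightarrow> int) \<Rightarrow> nat \<Rightarrow> int" where
  "dual_cone_point m = (\<lambda>(c, y). \<lambda>i\<in>{1..m + 2}.
     if i \<le> m then (2 * c * y i) mod int p else if i = m + 1 then c\<^sup>2 mod int p
     else (\<Sum>i\<in>{1..m}. (y i)\<^sup>2) mod int p)"

lemma cone_point_in_cone:
  assumes v: "\<And>t. t \<in> {1..<int p} \<Longrightarrow> [t * v t = 1] (mod int p)"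
    and t: "t \<in> {1..<int p}" and \<zeta>: "\<zeta> \<in> {1..m} \<rightarrow>\<^sub>E {0..<int p}"
  shows "cone_point m v (t, \<zeta>) \<in> quad_cone R (m + 2)"
proof -
  let ?S = "\<Sum>i\<in>{1..m}. (\<zeta> i)\<^sup>2"
  have "[(v t * ?S) mod int p * t = v t * ?S * t] (mod int p)"
    by (intro cong_mult) auto
  also have "v t * ?S * t = (t * v t) * ?S" by simp
  also have "[(t * v t) * ?S = 1 * ?S] (mod int p)"
    by (intro cong_mult v t) auto
  also have "1 * ?S = (\<Sum>i\<in>{1..m}. (cone_point m v (t, \<zeta>) i)\<^sup>2)"
    by (simp add: cone_point_def)
  finally show ?thesis
    using t \<zeta> p_pos by (auto simp: quad_cone_eq vec_space_eq cone_point_def PiE_iff)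
qed

lemma inj_cone_point: "inj_on (cone_point m v) (U \<times> ({1..m} \<rightarrow>\<^sub>E Z))"
proof (rule inj_onI, clarify)
  fix t \<zeta> t' \<zeta>'
  assume h: "\<zeta> \<in> {1..m} \<rightarrow>\<^sub>E Z" "\<zeta>' \<in> {1..m} \<rightarrow>\<^sub>E Z"
    and "cone_point m v (t, \<zeta>) = cone_point m v (t', \<zeta>')"
  then have eq: "cone_point m v (t, \<zeta>) i = cone_point m v (t', \<zeta>') i" for i by simp
  have "t = t'" using eq[of "m + 2"] by (simp add: cone_point_def)
  moreover have "\<zeta> = \<zeta>'"
  proof (rule PiE_ext[OF h])
    fix i assume "i \<in> {1..m}"
    then show "\<zeta> i = \<zeta>' i" using eq[of i] by (simp add: cone_point_def)
  qed
  ultimately show "t = t' \<and> \<zeta> = \<zeta>'" by simp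
qed

lemma dual_cone_point_in_space: "dual_cone_point m cy \<in> vec_space R (m + 2)"
  using p_pos by (auto simp: vec_space_eq dual_cone_point_def split: prod.split)

text \<open>Coordinate n - 1 determines \<open>c\<close> only up to sign. For \<open>c\<close> and
  \<open>d\<close> at most \<open>(p - 1) / 2\<close>, however, \<open>0 < c + d < p\<close>, which
  excludes \<open>c = - d\<close>. As \<open>2 * c\<close> is invertible, the first \<open>m\<close>
  coordinates then give \<open>y\<close>.\<close>

lemma inj_dual_cone_point:
  "inj_on (dual_cone_point m) ({1..(int p - 1) div 2} \<times> ({1..m} \<rightarrow>\<^sub>E {0..<int p}))"
proof (rule inj_onI, clarify)
  fix c y d z
  assume c: "c \<in> {1..(int p - 1) div 2}" and d: "d \<in> {1..(int p - 1) div 2}"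
    and y: "y \<in> {1..m} \<rightarrow>\<^sub>E {0..<int p}" and z: "z \<in> {1..m} \<rightarrow>\<^sub>E {0..<int p}"
    and "dual_cone_point m (c, y) = dual_cone_point m (d, z)"
  then have eq: "dual_cone_point m (c, y) i = dual_cone_point m (d, z) i" for i by simp
  have "[c\<^sup>2 = d\<^sup>2] (mod int p)"
    using eq[of "m + 1"] by (simp add: dual_cone_point_def cong_def)
  then have "int p dvd (c - d) * (c + d)"
    by (simp add: cong_iff_dvd_diff power2_eq_square algebra_simps)
  moreover have "\<not> int p dvd c + d"
    using c d by (intro zdvd_not_zless) auto
  ultimately have "int p dvd c - d"
    using p_prime by (simp add: prime_dvd_mult_iff)
  then have "[c = d] (mod int p)" by (simp add: cong_iff_dvd_diff)
  then have cd: "c = d" by (rule cong_residue_eq[rotated 2]) (use c d in auto)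
  have "coprime c (int p)" using c by (subst coprime_p_iff) auto
  then have cop: "coprime (2 * c) (int p)" using p_odd by simp
  have "y = z"
  proof (rule PiE_ext[OF y z])
    fix i assume i: "i \<in> {1..m}"
    then have "[2 * c * y i = 2 * c * z i] (mod int p)"
      using eq[of i] cd by (simp add: dual_cone_point_def cong_def)
    then have "[y i = z i] (mod int p)" using cop by (simp add: cong_mult_lcancel)
    then show "y i = z i" by (rule cong_residue_eq[rotated 2]) (use y z i in auto)
  qed
  with cd show "c = d \<and> y = z" by simp
qed

text \<open>The sum factors into one quadratic sum per coordinate. Completing the squares leaves the
  phases \<open>- t * (y i)^2\<close>, and the last coordinate of the dual point, the sum of the
  \<open>(y i)^2\<close>, is chosen to cancel them. Only a quantity depending on \<open>t\<close>
  remains, which a weight in the last variable can correct.\<close>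

lemma cone_sum_eq_gauss_sum_power:
  assumes v: "[t * v t = 1] (mod int p)" and c: "coprime c (int p)"
  shows "(\<Sum>\<zeta>\<in>{1..m} \<rightarrow>\<^sub>E {0..<int p}.
      unit_char p (\<Sum>i\<in>{1..m + 2}. dual_cone_point m (c, y) i * cone_point m v (t, \<zeta>) i))
    = gauss_sum p (v t) ^ m"
proof -
  let ?Y = "\<Sum>i\<in>{1..m}. (y i)\<^sup>2"
  have "unit_char p (\<Sum>i\<in>{1..m + 2}. dual_cone_point m (c, y) i * cone_point m v (t, \<zeta>) i)
      = unit_char p (t * ?Y) * (\<Prod>i\<in>{1..m}. unit_char p (c\<^sup>2 * v t * (\<zeta> i)\<^sup>2 + 2 * c * y i * \<zeta> i))"
    for \<zeta>
  proof -
    let ?S = "\<Sum>i\<in>{1..m}. (\<zeta> i)\<^sup>2"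
    have "(\<Sum>i\<in>{1..m + 2}. dual_cone_point m (c, y) i * cone_point m v (t, \<zeta>) i)
        = (\<Sum>i\<in>{1..m}. (2 * c * y i) mod int p * \<zeta> i)
          + c\<^sup>2 mod int p * ((v t * ?S) mod int p) + ?Y mod int p * t"
      by (simp add: dual_cone_point_def cone_point_def numeral_2_eq_2)
    also have "[\<dots> = (\<Sum>i\<in>{1..m}. 2 * c * y i * \<zeta> i) + c\<^sup>2 * (v t * ?S) + ?Y * t] (mod int p)"
      by (intro cong_add cong_mult cong_sum) auto
    also have "(\<Sum>i\<in>{1..m}. 2 * c * y i * \<zeta> i) + c\<^sup>2 * (v t * ?S) + ?Y * t
        = t * ?Y + (\<Sum>i\<in>{1..m}. c\<^sup>2 * v t * (\<zeta> i)\<^sup>2 + 2 * c * y i * \<zeta> i)"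
      by (simp add: sum.distrib sum_distrib_left mult_ac)
    finally have "unit_char p (\<Sum>i\<in>{1..m + 2}. dual_cone_point m (c, y) i * cone_point m v (t, \<zeta>) i)
        = unit_char p (t * ?Y + (\<Sum>i\<in>{1..m}. c\<^sup>2 * v t * (\<zeta> i)\<^sup>2 + 2 * c * y i * \<zeta> i))"
      by (rule unit_char_cong[OF p_pos])
    then show ?thesis by (simp only: unit_char_add[of p "t * ?Y"] unit_char_sum)
  qed
  then have "(\<Sum>\<zeta>\<in>{1..m} \<rightarrow>\<^sub>E {0..<int p}.
      unit_char p (\<Sum>i\<in>{1..m + 2}. dual_cone_point m (c, y) i * cone_point m v (t, \<zeta>) i))
    = unit_char p (t * ?Y) * (\<Prod>i\<in>{1..m}. \<Sum>u\<in>{0..<int p}.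
        unit_char p (c\<^sup>2 * v t * u\<^sup>2 + 2 * c * y i * u))"
    by (simp add: prod_sum_PiE sum_distrib_left)
  also have "\<dots> = unit_char p (t * ?Y) * (\<Prod>i\<in>{1..m}. unit_char p (- t * (y i)\<^sup>2)) * gauss_sum p (v t) ^ m"
    by (simp add: sum_unit_char_quadratic[OF p_pos c v] prod.distrib)
  also have "unit_char p (t * ?Y) * (\<Prod>i\<in>{1..m}. unit_char p (- t * (y i)\<^sup>2)) = 1"
    by (simp add: unit_char_sum[symmetric] unit_char_add[symmetric] sum_distrib_left sum_negf)
  finally show ?thesis by simp
qed

text \<open>The weights cancel the phases of the Gauss sums, so that the extension is as large
  as possible at all points of (half of) the dual cone, for odd \<open>n\<close> as well.\<close>

lemma cone_test:
  fixes s r :: ennreal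
  assumes n: "n \<ge> 3" and s: "1 \<le> s" and r: "1 \<le> r" "r \<noteq> \<infinity>" and K: "R_star R n s r \<le> K"
  shows "((real p - 1) / 2 * real p ^ (n - 2)) powr enn2real (1 / r) * ((real p - 1) * sqrt (real p) ^ (n - 2))
    \<le> 2 * K * real p ^ (n - 1)"
proof -
  obtain m where m: "n = m + 2" using n by (metis add.commute le_Suc_ex numeral_3_eq_3 Suc_leD numeral_2_eq_2)
  obtain v where v: "\<And>t. t \<in> {1..<int p} \<Longrightarrow> [t * v t = 1] (mod int p)"
    by (rule residue_inverses) blast
  have cop_v: "coprime (v t) (int p)" if "t \<in> {1..<int p}" for t
  proof -
    have "coprime (t * v t) (int p)" using cong_imp_coprime[OF cong_sym[OF v[OF that]]] by simp
    then show ?thesis by simp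
  qed
  define G where "G t = gauss_sum p (v t)" for t
  have G: "norm (G t) = sqrt (real p)" if "t \<in> {1..<int p}" for t
    using gauss_sum_norm[OF p_odd cop_v[OF that]] by (metis G_def norm_ge_zero real_sqrt_unique)
  define Z where "Z = {1..m} \<rightarrow>\<^sub>E {0..<int p}"
  \<comment> \<open>The weight depends on \<open>\<xi>\<close> only through its last coordinate
    \<open>t\<close>. It has modulus one on \<open>A\<close>, because \<open>sqrt p\<close> is the
    modulus of \<open>G t\<close>.\<close>
  define f where "f \<xi> = (cnj (G (\<xi> n)) / of_real (sqrt (real p))) ^ m" for \<xi> :: "nat \<Rightarrow> int"
  define A where "A = cone_point m v ` ({1..<int p} \<times> Z)"
  define B where "B = dual_cone_point m ` ({1..(int p - 1) div 2} \<times> Z)"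
  have cardZ: "card Z = p ^ m" by (simp add: Z_def card_PiE)
  have p1: "p > 1" using p_prime by (rule prime_gt_1_nat)
  have last: "cone_point m v (t, \<zeta>) n = t" for t \<zeta> by (simp add: cone_point_def m)
  have AC: "A \<subseteq> quad_cone R n"
    using cone_point_in_cone v by (auto simp: A_def Z_def m)
  have "Z \<noteq> {}" using cardZ p1 by (metis card.empty power_not_zero not_one_less_zero)
  then have A0: "A \<noteq> {}" using p1 by (simp add: A_def)
  have "real (card B) powr enn2real (1 / r) * ((real p - 1) * sqrt (real p) ^ m)
    \<le> K * (real (card A) / real (card (quad_cone R n))) powr enn2real (1 / s) * real (card (quad_cone R n))"
  proof (rule extension_test[OF n s r K AC A0])
    show "B \<subseteq> vec_space R n" using dual_cone_point_in_space by (auto simp: B_def m)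
    show "0 \<le> (real p - 1) * sqrt (real p) ^ m" using p1 by simp
    show "norm (f \<xi>) \<le> 1" if \<xi>: "\<xi> \<in> A" for \<xi>
    proof -
      obtain t \<zeta> where t: "t \<in> {1..<int p}" "\<xi> = cone_point m v (t, \<zeta>)"
        using \<xi> by (auto simp: A_def)
      then show ?thesis using p1 G[OF t(1)] last by (simp add: f_def norm_power norm_divide)
    qed
    fix x assume "x \<in> B"
    then obtain c y where cy: "c \<in> {1..(int p - 1) div 2}" "x = dual_cone_point m (c, y)"
      by (auto simp: B_def)
    have c: "coprime c (int p)" using cy(1) by (subst coprime_p_iff) auto
    have "(\<Sum>\<xi>\<in>A. f \<xi> * unit_char p (\<Sum>i\<in>{1..n}. x i * \<xi> i))
        = (\<Sum>(t, \<zeta>)\<in>{1..<int p} \<times> Z. (cnj (G t) / of_real (sqrt (real p))) ^ m *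
            unit_char p (\<Sum>i\<in>{1..n}. x i * cone_point m v (t, \<zeta>) i))"
      unfolding A_def Z_def
      by (subst sum.reindex[OF inj_cone_point]) (auto intro!: sum.cong simp: f_def last)
    also have "\<dots> = (\<Sum>t\<in>{1..<int p}. (cnj (G t) / of_real (sqrt (real p))) ^ m *
            (\<Sum>\<zeta>\<in>Z. unit_char p (\<Sum>i\<in>{1..n}. x i * cone_point m v (t, \<zeta>) i)))"
      by (simp add: sum.cartesian_product sum_distrib_left)
    also have "\<dots> = (\<Sum>t\<in>{1..<int p}. (cnj (G t) / of_real (sqrt (real p))) ^ m * G t ^ m)"
      using cone_sum_eq_gauss_sum_power[where v = v, OF v c] by (intro sum.cong) (simp_all add: cy(2) Z_def m G_def)
    also have "\<dots> = (\<Sum>t\<in>{1..<int p}. of_real (sqrt (real p) ^ m))"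
    proof (rule sum.cong)
      fix t assume t: "t \<in> {1..<int p}"
      have "cnj (G t) * G t = of_real (real p)"
        using complex_norm_square[of "G t"] G[OF t] by (simp add: mult.commute)
      also have "\<dots> = of_real (sqrt (real p) * sqrt (real p))"
        by (simp only: real_sqrt_mult_self abs_of_nat)
      finally have "cnj (G t) / of_real (sqrt (real p)) * G t = of_real (sqrt (real p))"
        using p1 by (simp add: field_simps flip: of_real_mult)
      then show "(cnj (G t) / of_real (sqrt (real p))) ^ m * G t ^ m = of_real (sqrt (real p) ^ m)"
        by (simp flip: power_mult_distrib)
    qed simp
    also have "\<dots> = of_real ((real p - 1) * sqrt (real p) ^ m)"
      using p1 by simp
    finally show "(real p - 1) * sqrt (real p) ^ m
        \<le> norm (\<Sum>\<xi>\<in>A. f \<xi> * unit_char p (\<Sum>i\<in>{1..n}. x i * \<xi> i))"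
      using p1 by (simp only: norm_of_real)
  qed
  \<comment> \<open>Since \<open>A\<close> lies in the cone and the exponent \<open>1 / s\<close> is
    nonnegative, the factor depending on \<open>s\<close> is at most 1.\<close>
  also have "\<dots> \<le> K * 1 * (2 * real p ^ (n - 1))"
  proof -
    have "0 \<le> K" using K R_star_nonneg[OF n s r(1)] by linarith
    have "card A \<le> card (quad_cone R n)" using AC by (intro card_mono) auto
    then have "real (card A) / real (card (quad_cone R n)) \<le> 1" by (simp add: divide_le_eq)
    then have "(real (card A) / real (card (quad_cone R n))) powr enn2real (1 / s) \<le> 1"
      using enn2real_one_divide(3)[OF s] by (intro powr_le1) auto
    moreover have "real (card (quad_cone R n)) \<le> 2 * real p ^ (n - 1)"
      using card_quad_cone_le[OF n] by (metis of_nat_le_iff of_nat_mult of_nat_numeral of_nat_power)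
    ultimately show ?thesis using \<open>0 \<le> K\<close> by (intro mult_mono) auto
  qed
  also have "real (card B) = (real p - 1) / 2 * real p ^ m"
  proof -
    have "card B = nat ((int p - 1) div 2) * p ^ m"
      using inj_dual_cone_point[of m] by (simp add: B_def Z_def card_image card_cartesian_product card_PiE)
    moreover have "real (nat ((int p - 1) div 2)) = (real p - 1) / 2"
      using p_odd by (auto elim!: oddE)
    ultimately show ?thesis by simp
  qed
  finally show ?thesis by (simp add: m)
qed

section \<open>Tests with isotropic subspaces\<close>

text \<open>\<open>A\<close> is the graph over the coordinates in \<open>J\<close> of the linear map with matrix \<open>a\<close>, and \<open>B\<close> its
  annihilator, the graph of minus the transpose. The extension of the indicator of \<open>A\<close> is
  \<open>card A / card C\<close> on \<open>B\<close>.\<close>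

lemma isotropic_test:
  fixes s r :: ennreal and a :: "nat \<Rightarrow> nat \<Rightarrow> int"
  assumes n: "n \<ge> 3" and s: "1 \<le> s" and r: "1 \<le> r" "r \<noteq> \<infinity>" and K: "R_star R n s r \<le> K"
    and J: "J \<subseteq> {1..n}" "card J < n"
    and isotropic: "\<And>\<xi>. (\<And>i. i \<in> {1..n} - J \<Longrightarrow> [\<xi> i = (\<Sum>j\<in>J. a i j * \<xi> j)] (mod int p))
      \<Longrightarrow> [\<xi> (n - 1) * \<xi> n = (\<Sum>i\<in>{1..n - 2}. (\<xi> i)\<^sup>2)] (mod int p)"
  shows "(real p ^ (n - card J)) powr enn2real (1 / r)
    \<le> K * (2 * real p ^ (n - 1 - card J)) powr (1 - enn2real (1 / s))"
proof -
  define \<alpha> where "\<alpha> = enn2real (1 / s)"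
  have \<alpha>: "0 \<le> \<alpha>" "\<alpha> \<le> 1" using enn2real_one_divide(3,4)[OF s] by (auto simp: \<alpha>_def)
  define I where "I = {1..n} - J"
  have finJ: "finite J" "finite I" using J by (auto simp: I_def intro: finite_subset)
  have cardI: "card I = n - card J" using J finJ by (simp add: I_def card_Diff_subset)
  define \<Phi> where "\<Phi> \<eta> = (\<lambda>i\<in>{1..n}. if i \<in> J then \<eta> i else (\<Sum>j\<in>J. a i j * \<eta> j) mod int p)" for \<eta>
  define \<Psi> where "\<Psi> \<zeta> = (\<lambda>i\<in>{1..n}. if i \<in> I then \<zeta> i else (- (\<Sum>k\<in>I. a k i * \<zeta> k)) mod int p)" for \<zeta>
  define A where "A = \<Phi> ` (J \<rightarrow>\<^sub>E {0..<int p})"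
  define B where "B = \<Psi> ` (I \<rightarrow>\<^sub>E {0..<int p})"
  have \<Phi>J: "\<Phi> \<eta> j = \<eta> j" if "j \<in> J" for \<eta> j using that J by (auto simp: \<Phi>_def)
  have \<Phi>I: "\<Phi> \<eta> i = (\<Sum>j\<in>J. a i j * \<eta> j) mod int p" if "i \<in> I" for \<eta> i
    using that by (auto simp: \<Phi>_def I_def)
  have \<Psi>I: "\<Psi> \<zeta> i = \<zeta> i" if "i \<in> I" for \<zeta> i using that by (auto simp: \<Psi>_def I_def)
  have \<Psi>J: "\<Psi> \<zeta> j = (- (\<Sum>k\<in>I. a k j * \<zeta> k)) mod int p" if "j \<in> J" for \<zeta> j
    using that J by (auto simp: \<Psi>_def I_def)
  have "inj_on \<Phi> (J \<rightarrow>\<^sub>E {0..<int p})"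
    by (rule inj_onI, rule PiE_ext) (use \<Phi>J in \<open>auto, metis\<close>)
  then have cardA: "card A = p ^ card J"
    using finJ by (simp add: A_def card_image card_PiE)
  have "inj_on \<Psi> (I \<rightarrow>\<^sub>E {0..<int p})"
    by (rule inj_onI, rule PiE_ext) (use \<Psi>I in \<open>auto, metis\<close>)
  then have cardB: "card B = p ^ (n - card J)"
    using finJ by (simp add: B_def card_image card_PiE cardI)
  have AC: "A \<subseteq> quad_cone R n"
  proof
    fix \<xi> assume "\<xi> \<in> A"
    then obtain \<eta> where \<eta>: "\<eta> \<in> J \<rightarrow>\<^sub>E {0..<int p}" "\<xi> = \<Phi> \<eta>" by (auto simp: A_def)
    have "\<xi> \<in> vec_space R n"
      using \<eta> p_pos by (auto simp: vec_space_eq \<Phi>_def)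
    moreover have "[\<xi> (n - 1) * \<xi> n = (\<Sum>i\<in>{1..n - 2}. (\<xi> i)\<^sup>2)] (mod int p)"
    proof (rule isotropic)
      fix i assume "i \<in> {1..n} - J"
      then show "[\<xi> i = (\<Sum>j\<in>J. a i j * \<xi> j)] (mod int p)"
        by (simp add: \<eta>(2) \<Phi>I \<Phi>J I_def)
    qed
    ultimately show "\<xi> \<in> quad_cone R n" by (simp add: quad_cone_eq)
  qed
  have A0: "A \<noteq> {}" using cardA p_pos by force
  have BX: "B \<subseteq> vec_space R n"
    using p_pos by (auto simp: B_def vec_space_eq \<Psi>_def)
  have ann: "unit_char p (\<Sum>i\<in>{1..n}. x i * \<xi> i) = 1" if mem: "x \<in> B" "\<xi> \<in> A" for x \<xi>
  proof -
    obtain \<eta> \<zeta> where h: "\<xi> = \<Phi> \<eta>" "x = \<Psi> \<zeta>" using mem by (auto simp: A_def B_def)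
    have "(\<Sum>i\<in>{1..n}. x i * \<xi> i) = (\<Sum>j\<in>J. x j * \<xi> j) + (\<Sum>k\<in>I. x k * \<xi> k)"
      using sum.subset_diff[OF J(1), of "\<lambda>i. x i * \<xi> i"] by (simp add: I_def add.commute)
    also have "\<dots> = (\<Sum>j\<in>J. (- (\<Sum>k\<in>I. a k j * \<zeta> k)) mod int p * \<eta> j)
        + (\<Sum>k\<in>I. \<zeta> k * ((\<Sum>j\<in>J. a k j * \<eta> j) mod int p))"
      by (simp add: h \<Phi>J \<Phi>I \<Psi>J \<Psi>I)
    also have "[\<dots> = (\<Sum>j\<in>J. (- (\<Sum>k\<in>I. a k j * \<zeta> k)) * \<eta> j)
        + (\<Sum>k\<in>I. \<zeta> k * (\<Sum>j\<in>J. a k j * \<eta> j))] (mod int p)"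
      by (intro cong_add cong_sum cong_mult) auto
    also have "(\<Sum>j\<in>J. (- (\<Sum>k\<in>I. a k j * \<zeta> k)) * \<eta> j)
        + (\<Sum>k\<in>I. \<zeta> k * (\<Sum>j\<in>J. a k j * \<eta> j)) = 0"
      unfolding sum_distrib_left by (subst sum.swap)
        (simp add: sum_distrib_left sum_distrib_right sum_negf mult_ac)
    finally show ?thesis
      using p_pos by (simp add: unit_char_eq_1_iff cong_iff_dvd_diff)
  qed
  define c where "c = real (card (quad_cone R n))"
  have c: "c > 0" using AC A0 by (auto simp: c_def card_gt_0_iff)
  define q where "q = real p ^ card J"
  have q: "q > 0" using p_pos by (simp add: q_def)
  have norm_eq: "norm (\<Sum>\<xi>\<in>A. unit_char p (\<Sum>i\<in>{1..n}. x i * \<xi> i)) = q" if "x \<in> B" for x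
    using ann[OF that] by (simp add: cardA q_def norm_power del: One_nat_def)
  have "real (card B) powr enn2real (1 / r) * q \<le> K * (real (card A) / c) powr \<alpha> * c"
    unfolding c_def \<alpha>_def
    by (rule extension_test[OF n s r K AC A0 BX, where f = "\<lambda>_. 1"])
      (use q norm_eq in \<open>auto simp del: One_nat_def\<close>)
  \<comment> \<open>Here \<open>q\<close> is the cardinality of \<open>A\<close>; splitting off one
    factor \<open>q\<close> lets it cancel against the size of the exponential sum on
    \<open>B\<close>.\<close>
  also have "\<dots> = K * (c / q) powr (1 - \<alpha>) * q"
    using c q by (simp add: cardA powr_divide powr_diff field_simps flip: q_def)
  finally have "real (card B) powr enn2real (1 / r) \<le> K * (c / q) powr (1 - \<alpha>)"
    using q by simp
  also have "\<dots> \<le> K * (2 * real p ^ (n - 1 - card J)) powr (1 - \<alpha>)"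
  \<comment> \<open>As \<open>1 - \<alpha>\<close> is nonnegative, an upper bound for the
    cardinality of the cone suffices.\<close>
  proof (intro mult_left_mono powr_mono2)
    show "0 \<le> K" using K R_star_nonneg[OF n s r(1)] by linarith
    have "c \<le> 2 * real p ^ (n - 1)"
      unfolding c_def using card_quad_cone_le[OF n] by (metis of_nat_le_iff of_nat_mult of_nat_numeral of_nat_power)
    also have "\<dots> = 2 * real p ^ (n - 1 - card J) * q"
      unfolding q_def using J(2) by (simp flip: power_add)
    finally show "c / q \<le> 2 * real p ^ (n - 1 - card J)" using q by (simp add: pos_divide_le_eq)
  qed (use c q \<alpha> in auto)
  finally show ?thesis by (simp add: cardB \<alpha>_def)
qed

text \<open>When \<open>b^2 = - 1\<close> the vector \<open>(1, b)\<close> is isotropic for a sum of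
  two squares. One such vector for each of the \<open>(n - 2) div 2\<close> pairs of coordinates,
  together with the last unit vector, spans an isotropic space of dimension
  \<open>n div 2\<close>.\<close>

lemma isotropic_test_minus_one_square:
  fixes s r :: ennreal
  assumes n: "n \<ge> 3" and s: "1 \<le> s" and r: "1 \<le> r" "r \<noteq> \<infinity>" and K: "R_star R n s r \<le> K"
    and b: "[b\<^sup>2 = - 1] (mod int p)"
  shows "(real p ^ (n - n div 2)) powr enn2real (1 / r)
    \<le> K * (2 * real p ^ (n - 1 - n div 2)) powr (1 - enn2real (1 / s))"
proof -
  define m where "m = (n - 2) div 2"
  define J where "J = insert n ((\<lambda>j. 2 * j + 1) ` {..<m})"
  define a :: "nat \<Rightarrow> nat \<Rightarrow> int" where "a k l = (if k = l + 1 then b else 0)" for k l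
  have m: "2 * m + 2 \<le> n" "n \<le> 2 * m + 3" using n by (auto simp: m_def)
  have cardJ: "card J = n div 2"
  proof -
    have "n \<notin> (\<lambda>j. 2 * j + 1) ` {..<m}" using m by auto
    moreover have "card ((\<lambda>j. 2 * j + 1) ` {..<m}) = m" by (subst card_image) (auto intro: inj_onI)
    ultimately show ?thesis using m by (simp add: J_def)
  qed
  have J: "J \<subseteq> {1..n}" using m by (auto simp: J_def)
  have finJ: "finite J" by (simp add: J_def)
  show ?thesis
  proof (rule isotropic_test[OF n s r K J, where a = a, unfolded cardJ])
    show "n div 2 < n" using n by simp
    fix \<xi> :: "nat \<Rightarrow> int"
    assume \<xi>: "\<And>k. k \<in> {1..n} - J \<Longrightarrow> [\<xi> k = (\<Sum>l\<in>J. a k l * \<xi> l)] (mod int p)"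
    \<comment> \<open>These rows of the matrix vanish. They comprise coordinate n - 1, which kills
      the product in the cone equation, and for odd \<open>n\<close> also the unpaired coordinate n
      - 2.\<close>
    have zero: "[\<xi> k = 0] (mod int p)" if k: "k \<in> {2 * m + 1..n - 1}" for k
    proof -
      have "(\<Sum>l\<in>J. a k l * \<xi> l) = 0"
        using k m by (intro sum.neutral) (auto simp: J_def a_def)
      moreover have "k \<in> {1..n} - J" using k m by (auto simp: J_def)
      ultimately show ?thesis using \<xi>[of k] by simp
    qed
    have pair: "[(\<xi> (2 * j + 1))\<^sup>2 + (\<xi> (2 * j + 2))\<^sup>2 = 0] (mod int p)" if j: "j < m" for j
    proof -
      have "(\<Sum>l\<in>J. a (2 * j + 2) l * \<xi> l) = (\<Sum>l\<in>{2 * j + 1}. a (2 * j + 2) l * \<xi> l)"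
        using j finJ by (intro sum.mono_neutral_right) (auto simp: J_def a_def)
      moreover have "2 * j + 2 \<in> {1..n} - J" using j m by (auto simp: J_def, presburger)
      ultimately have "[\<xi> (2 * j + 2) = b * \<xi> (2 * j + 1)] (mod int p)"
        using \<xi>[of "2 * j + 2"] by (simp add: a_def)
      then have "[(\<xi> (2 * j + 1))\<^sup>2 + (\<xi> (2 * j + 2))\<^sup>2
          = (\<xi> (2 * j + 1))\<^sup>2 + (b * \<xi> (2 * j + 1))\<^sup>2] (mod int p)"
        by (intro cong_add cong_pow) auto
      also have "(\<xi> (2 * j + 1))\<^sup>2 + (b * \<xi> (2 * j + 1))\<^sup>2 = (\<xi> (2 * j + 1))\<^sup>2 * (1 + b\<^sup>2)"
        by (simp add: power_mult_distrib algebra_simps)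
      also have "[\<dots> = (\<xi> (2 * j + 1))\<^sup>2 * (1 + (- 1))] (mod int p)"
        by (intro cong_mult cong_add b) auto
      finally show ?thesis by simp
    qed
    have "{1..n - 2} = {1..2 * m} \<union> {2 * m + 1..n - 2}" using m by auto
    then have "(\<Sum>i\<in>{1..n - 2}. (\<xi> i)\<^sup>2)
        = (\<Sum>i\<in>{1..2 * m}. (\<xi> i)\<^sup>2) + (\<Sum>i\<in>{2 * m + 1..n - 2}. (\<xi> i)\<^sup>2)"
      by (simp add: sum.union_disjoint ivl_disj_int)
    also have "[\<dots> = (\<Sum>j<m. 0) + (\<Sum>i\<in>{2 * m + 1..n - 2}. 0\<^sup>2)] (mod int p)"
      unfolding sum_pairs by (intro cong_add cong_sum cong_pow pair zero) auto
    finally have "[(\<Sum>i\<in>{1..n - 2}. (\<xi> i)\<^sup>2) = 0] (mod int p)" by simp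
    moreover have "[\<xi> (n - 1) * \<xi> n = 0 * \<xi> n] (mod int p)"
      using m by (intro cong_mult zero) auto
    ultimately show "[\<xi> (n - 1) * \<xi> n = (\<Sum>i\<in>{1..n - 2}. (\<xi> i)\<^sup>2)] (mod int p)"
      by (simp add: cong_def)
  qed
qed

text \<open>Modulo \<open>p\<close> the vectors \<open>(1, 0, 1, b)\<close> and \<open>(0, 1, - b, 1)\<close> are isotropic and orthogonal.\<close>

lemma isotropic_test_minus_two_square:
  fixes s r :: ennreal
  assumes n: "n \<ge> 3" "n mod 4 = 0" and s: "1 \<le> s" and r: "1 \<le> r" "r \<noteq> \<infinity>"
    and K: "R_star R n s r \<le> K" and b: "[b\<^sup>2 = - 2] (mod int p)"
  shows "(real p ^ (n - (n - 2) div 2)) powr enn2real (1 / r)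
    \<le> K * (2 * real p ^ (n - 1 - (n - 2) div 2)) powr (1 - enn2real (1 / s))"
proof -
  \<comment> \<open>The n - 2 coordinates of the sum of squares form \<open>m\<close> blocks of four
    and two left over. Each block contributes dimension 2 and the last unit vector 1, in total
    \<open>2 * m + 1 = (n - 2) div 2\<close>.\<close>
  define m where "m = n div 4 - 1"
  define J where "J = insert n ((\<lambda>j. 4 * j + 1) ` {..<m} \<union> (\<lambda>j. 4 * j + 2) ` {..<m})"
  \<comment> \<open>If \<open>x\<close> and \<open>y\<close> are the first two entries of a block,
    the rows congruent to 3 and 0 modulo 4 give the other two as \<open>x - b * y\<close> and
    \<open>b * x + y\<close>.\<close>
  define a :: "nat \<Rightarrow> nat \<Rightarrow> int" where
    "a k l = (if k mod 4 = 3 then (if k = l + 2 then 1 else if k = l + 1 then - b else 0)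
       else if k mod 4 = 0 then (if k = l + 3 then b else if k = l + 2 then 1 else 0) else 0)" for k l
  have m: "n = 4 * m + 4" using n by (auto simp: m_def)
  have cardJ: "card J = (n - 2) div 2"
  proof -
    have "n \<notin> (\<lambda>j. 4 * j + 1) ` {..<m} \<union> (\<lambda>j. 4 * j + 2) ` {..<m}" using m by auto
    moreover have "card ((\<lambda>j. 4 * j + 1) ` {..<m} \<union> (\<lambda>j. 4 * j + 2) ` {..<m}) = m + m"
      by (subst card_Un_disjoint) (auto simp: card_image inj_on_def, presburger)
    ultimately show ?thesis using m by (simp add: J_def)
  qed
  have J: "J \<subseteq> {1..n}" using m by (auto simp: J_def)
  have finJ: "finite J" by (simp add: J_def)
  show ?thesis
  proof (rule isotropic_test[OF n(1) s r K J, where a = a, unfolded cardJ])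
    show "(n - 2) div 2 < n" using n by simp
    fix \<xi> :: "nat \<Rightarrow> int"
    assume \<xi>: "\<And>k. k \<in> {1..n} - J \<Longrightarrow> [\<xi> k = (\<Sum>l\<in>J. a k l * \<xi> l)] (mod int p)"
    \<comment> \<open>Row \<open>4 * m + 3\<close> has the form of a block row, but its nonzero
      columns \<open>4 * m + 1\<close> and \<open>4 * m + 2\<close> lie outside
      \<open>J\<close>.\<close>
    have zero: "[\<xi> k = 0] (mod int p)" if k: "k \<in> {4 * m + 1..4 * m + 3}" for k
    proof -
      have "k = 4 * m + 1 \<or> k = 4 * m + 2 \<or> k = 4 * m + 3" using k by auto
      then have "k mod 4 \<noteq> 0" by presburger
      moreover have "l + 2 < k \<or> k < l" if "l \<in> J" for l
        using that k m by (auto simp: J_def)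
      ultimately have "(\<Sum>l\<in>J. a k l * \<xi> l) = 0"
        by (intro sum.neutral) (fastforce simp: a_def)
      moreover have "k \<in> {1..n} - J" using k m by (auto simp: J_def)
      ultimately show ?thesis using \<xi>[of k] by simp
    qed
    have quadruple: "[(\<xi> (4 * j + 1))\<^sup>2 + (\<xi> (4 * j + 2))\<^sup>2 + (\<xi> (4 * j + 3))\<^sup>2 + (\<xi> (4 * j + 4))\<^sup>2 = 0]
        (mod int p)" if j: "j < m" for j
    proof -
      let ?x = "\<xi> (4 * j + 1)" and ?y = "\<xi> (4 * j + 2)"
      have mod4: "(4 * j + 3) mod 4 = 3" "\<not> 4 dvd 4 * j + 3" by presburger+
      have row: "(\<Sum>l\<in>J. a k l * \<xi> l) = (\<Sum>l\<in>{4 * j + 1, 4 * j + 2}. a k l * \<xi> l)"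
        if "k = 4 * j + 3 \<or> k = 4 * j + 4" for k
      proof (intro sum.mono_neutral_right finJ ballI)
        show "{4 * j + 1, 4 * j + 2} \<subseteq> J" using j by (auto simp: J_def)
        fix l assume "l \<in> J - {4 * j + 1, 4 * j + 2}"
        then have "l \<noteq> 4 * j + 1 \<and> l \<noteq> 4 * j + 2 \<and> l \<noteq> 4 * j + 3" using m j
          by (auto simp: J_def; presburger)
        then show "a k l * \<xi> l = 0" using that mod4 by (auto simp: a_def)
      qed
      have "(\<Sum>l\<in>J. a (4 * j + 3) l * \<xi> l) = ?x - b * ?y" "(\<Sum>l\<in>J. a (4 * j + 4) l * \<xi> l) = b * ?x + ?y"
        using mod4 by (subst row; simp add: a_def)+
      moreover have "4 * j + 3 \<in> {1..n} - J" "4 * j + 4 \<in> {1..n} - J"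
        using j m by (auto simp: J_def, presburger+)
      ultimately have xy: "[\<xi> (4 * j + 3) = ?x - b * ?y] (mod int p)" "[\<xi> (4 * j + 4) = b * ?x + ?y] (mod int p)"
        using \<xi>[of "4 * j + 3"] \<xi>[of "4 * j + 4"] by simp_all
      then have "[?x\<^sup>2 + ?y\<^sup>2 + (\<xi> (4 * j + 3))\<^sup>2 + (\<xi> (4 * j + 4))\<^sup>2
          = ?x\<^sup>2 + ?y\<^sup>2 + (?x - b * ?y)\<^sup>2 + (b * ?x + ?y)\<^sup>2] (mod int p)"
        by (intro cong_add cong_pow) auto
      \<comment> \<open>The mixed terms in \<open>x * y\<close> cancel, which is the orthogonality
        of the two spanning vectors.\<close>
      also have "?x\<^sup>2 + ?y\<^sup>2 + (?x - b * ?y)\<^sup>2 + (b * ?x + ?y)\<^sup>2 = (?x\<^sup>2 + ?y\<^sup>2) * (2 + b\<^sup>2)"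
        by (simp add: power2_eq_square algebra_simps)
      also have "[\<dots> = (?x\<^sup>2 + ?y\<^sup>2) * (2 + (- 2))] (mod int p)"
        by (intro cong_mult cong_add b) auto
      finally show ?thesis by simp
    qed
    have "{1..n - 2} = {1..4 * m} \<union> {4 * m + 1..4 * m + 2}" using m by auto
    then have "(\<Sum>i\<in>{1..n - 2}. (\<xi> i)\<^sup>2)
        = (\<Sum>i\<in>{1..4 * m}. (\<xi> i)\<^sup>2) + (\<Sum>i\<in>{4 * m + 1..4 * m + 2}. (\<xi> i)\<^sup>2)"
      by (simp only:) (intro sum.union_disjoint; auto)
    also have "[\<dots> = (\<Sum>j<m. 0) + (\<Sum>i\<in>{4 * m + 1..4 * m + 2}. 0\<^sup>2)] (mod int p)"
      unfolding sum_quadruples by (intro cong_add[OF cong_sum cong_sum] cong_pow quadruple zero) auto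
    finally have "[(\<Sum>i\<in>{1..n - 2}. (\<xi> i)\<^sup>2) = 0] (mod int p)" by simp
    moreover have "[\<xi> (n - 1) * \<xi> n = 0 * \<xi> n] (mod int p)"
      using m by (intro cong_mult zero) auto
    ultimately show "[\<xi> (n - 1) * \<xi> n = (\<Sum>i\<in>{1..n - 2}. (\<xi> i)\<^sup>2)] (mod int p)"
      by (simp add: cong_def)
  qed
qed

lemma minus_one_is_square_iff: "minus_one_is_square R \<longleftrightarrow> (\<exists>a. [a\<^sup>2 = - 1] (mod int p))"
proof
  assume "minus_one_is_square R"
  then show "\<exists>a. [a\<^sup>2 = - 1] (mod int p)"
    by (auto simp: minus_one_is_square_def res_mult_eq res_neg_eq res_one_eq cong_def power2_eq_square)
next
  assume "\<exists>a. [a\<^sup>2 = - 1] (mod int p)"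
  then obtain a where "[a\<^sup>2 = - 1] (mod int p)" by blast
  then have "(a mod int p) \<otimes> (a mod int p) = \<ominus> \<one>"
    by (simp add: res_mult_eq res_neg_eq res_one_eq cong_def power2_eq_square mod_simps)
  then show "minus_one_is_square R"
    unfolding minus_one_is_square_def by (intro bexI[of _ "a mod int p"]) auto
qed

end

section \<open>Primes modulo which -1 or -2 is a square\<close>

text \<open>A product congruent to 3 modulo 4 has a factor congruent to 3. Either the chosen prime
  factor is one, or the smaller cofactor is and the induction goes on with it.\<close>

lemma prime_factor_3_mod_4:
  fixes x :: nat
  assumes "x mod 4 = 3"
  obtains p where "prime p" "p dvd x" "p mod 4 = 3"
  using assms
proof (induction x arbitrary: thesis rule: less_induct)
  case (less x)
  then have "x \<noteq> 1" by auto
  then obtain p where p: "prime p" "p dvd x" using prime_factor_nat by metis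
  then obtain y where y: "x = p * y" by blast
  have "x mod 4 = ((p mod 4) * (y mod 4)) mod 4" by (simp add: y mod_mult_eq)
  moreover have "p mod 4 \<in> {0, 1, 2, 3}" "y mod 4 \<in> {0, 1, 2, 3}" by (simp; presburger)+
  ultimately have "p mod 4 = 3 \<or> y mod 4 = 3" using less.prems(2) by auto
  then show ?case
  proof
    assume "y mod 4 = 3"
    moreover have "y < x"
      using y less.prems(2) mult_strict_right_mono[OF prime_gt_1_nat[OF p(1)], of y] by (cases "y = 0") auto
    ultimately obtain q where "prime q" "q dvd y" "q mod 4 = 3" using less.IH by blast
    then show ?thesis using less.prems(1) y by auto
  qed (use less.prems p in blast)
qed

lemma prime_minus_one_square:
  fixes N :: nat
  obtains p b where "p > N" "prime p" "odd p" "[b\<^sup>2 = - 1] (mod int p)"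
proof -
  \<comment> \<open>The factorial rules out prime factors of \<open>M^2 + 1\<close> up to
    \<open>N\<close>, and the factor 2 makes \<open>M^2 + 1\<close> odd.\<close>
  define M :: nat where "M = 2 * fact N"
  have "M\<^sup>2 + 1 \<noteq> 1" by (simp add: M_def)
  then obtain p where p: "prime p" "p dvd M\<^sup>2 + 1" using prime_factor_nat by metis
  have not_dvd: "\<not> p dvd M"
  proof
    assume "p dvd M"
    then have "p dvd M\<^sup>2" by (simp add: power2_eq_square)
    then show False using p by (metis dvd_add_right_iff not_prime_unit)
  qed
  have "p > N"
    using not_dvd p(1) by (auto simp: M_def prime_dvd_fact_iff prime_dvd_mult_iff not_le[symmetric])
  moreover have "odd p"
    using p(2) by (auto simp: M_def dest: dvd_trans)
  moreover have "[(int M)\<^sup>2 = - 1] (mod int p)"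
  proof -
    have "int p dvd int (M\<^sup>2 + 1)" using p(2) by (simp only: int_dvd_int_iff)
    then show ?thesis by (simp add: cong_iff_dvd_diff add.commute)
  qed
  ultimately show thesis using that p(1) by blast
qed

lemma prime_minus_two_square:
  fixes N :: nat
  obtains p b where "p > N" "prime p" "p mod 4 = 3" "[b\<^sup>2 = - 2] (mod int p)"
proof -
  \<comment> \<open>A product of odd numbers, unlike a factorial, keeps \<open>M\<close> odd, so
    that \<open>M^2 + 2\<close> is congruent to 3 modulo 4. An odd \<open>p = 2 * k + 1\<close> up
    to \<open>N\<close> would be the factor with index \<open>k\<close>, hence divide 2.\<close>
  define M :: nat where "M = (\<Prod>k\<le>N. 2 * k + 1)"
  have "odd M" by (simp add: M_def even_prod_iff)
  then obtain j where "M = 2 * j + 1" by (auto elim: oddE)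
  then have "M\<^sup>2 + 2 = 4 * (j * j + j) + 3" by (simp add: power2_eq_square algebra_simps)
  then have "(M\<^sup>2 + 2) mod 4 = 3" by (simp only:) presburger
  then obtain p where p: "prime p" "p dvd M\<^sup>2 + 2" "p mod 4 = 3" by (rule prime_factor_3_mod_4)
  have "odd p" using p(3) by presburger
  then obtain k where k: "p = 2 * k + 1" by (auto elim: oddE)
  have "p > N"
  proof (rule ccontr)
    assume "\<not> p > N"
    then have "p dvd M" unfolding M_def using k by (intro dvd_prod_eqI[of _ k]) auto
    then have "p dvd M\<^sup>2" by (simp add: power2_eq_square)
    then have "p dvd 2" using p by (metis dvd_add_right_iff)
    then have "p \<le> 2" by (rule dvd_imp_le) simp
    moreover have "p > 1" using p(1) by (rule prime_gt_1_nat)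
    ultimately have "p = 2" by simp
    then show False using \<open>odd p\<close> by simp
  qed
  moreover have "[(int M)\<^sup>2 = - 2] (mod int p)"
  proof -
    have "int p dvd int (M\<^sup>2 + 2)" using p(2) by (simp only: int_dvd_int_iff)
    then show ?thesis by (simp add: cong_iff_dvd_diff add.commute)
  qed
  ultimately show thesis using that p by blast
qed

text \<open>Raise the congruence to the power \<open>(p - 1) div 2\<close>, which is odd: one side
  becomes 1 by Fermat's theorem, the other stays -1, and \<open>p\<close> would divide 2.\<close>

lemma not_square_minus_one:
  fixes a :: int
  assumes "prime p" "p mod 4 = 3"
  shows "\<not> [a\<^sup>2 = - 1] (mod int p)"
proof
  assume a: "[a\<^sup>2 = - 1] (mod int p)"
  define b where "b = nat (a mod int p)"
  have p: "p > 1" using assms(1) by (rule prime_gt_1_nat)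
  then have "int b = a mod int p" by (simp add: b_def)
  then have "[int b = a] (mod int p)" by simp
  then have b: "[(int b)\<^sup>2 = - 1] (mod int p)" using a cong_pow cong_trans by blast
  have "\<not> p dvd b"
  proof
    assume "p dvd b"
    then have "int p dvd (int b)\<^sup>2" by (simp add: power2_eq_square)
    then have "int p dvd - 1" using b by (simp add: cong_dvd_iff)
    then show False using p by simp
  qed
  then have "[b ^ (p - 1) = 1] (mod p)" using assms(1) by (intro fermat_theorem)
  then have "[int (b ^ (p - 1)) = int 1] (mod int p)" by (simp only: cong_int_iff)
  moreover have "p - 1 = 2 * ((p - 1) div 2)" "odd ((p - 1) div 2)" using assms(2) by presburger+
  then have "int (b ^ (p - 1)) = ((int b)\<^sup>2) ^ ((p - 1) div 2)"
    by (metis of_nat_power power_mult)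
  moreover have "[((int b)\<^sup>2) ^ ((p - 1) div 2) = (- 1) ^ ((p - 1) div 2)] (mod int p)"
    using b by (rule cong_pow)
  ultimately have "[(- 1) ^ ((p - 1) div 2) = 1] (mod int p)"
    by (metis cong_sym cong_trans of_nat_1)
  then have "[- 1 = 1] (mod int p)" using \<open>odd ((p - 1) div 2)\<close> by simp
  then have "int p dvd 2" by (simp add: cong_iff_dvd_diff)
  then have "p \<le> 2" using zdvd_imp_le by fastforce
  then show False using assms(2) p by simp
qed

section \<open>Exponents\<close>

text \<open>A positive power tends to infinity, so it is bounded on no unbounded set of
  \<open>p\<close>. The hypothesis asks only for such a set because only selected primes are
  tested.\<close>

lemma nonpos_exponent_if_bounded:
  fixes s K :: real
  assumes "\<And>N. \<exists>p>N. real p powr s \<le> K"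
  shows "s \<le> 0"
proof (rule ccontr)
  assume "\<not> s \<le> 0"
  then have "s > 0" by simp
  then have "filterlim (\<lambda>n. real n powr s) at_top sequentially" by real_asymp
  then have "eventually (\<lambda>n. real n powr s > K) sequentially"
    by (simp add: filterlim_at_top_dense)
  then obtain N where "\<And>n. n \<ge> N \<Longrightarrow> real n powr s > K" by (auto simp: eventually_sequentially)
  then show False using assms[of N] by (meson less_imp_le not_less)
qed

text \<open>The left side of the test grows with exponent
  \<open>(n - 1) * \<beta> + 1 + (n - 2) / 2\<close>, the right side with exponent
  \<open>n - 1\<close>.\<close>

lemma cone_test_exponent:
  fixes \<beta> K :: real
  assumes n: "n \<ge> 3" and \<beta>: "0 \<le> \<beta>" "\<beta> \<le> 1"
    and test: "\<And>N. \<exists>p>N. ((real p - 1) / 2 * real p ^ (n - 2)) powr \<beta> * ((real p - 1) * sqrt (real p) ^ (n - 2))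
      \<le> 2 * K * real p ^ (n - 1)"
  shows "\<beta> \<le> (real n - 2) / (2 * real n - 2)"
proof -
  have "(real n - 1) * \<beta> - (real n - 2) / 2 \<le> 0"
  proof (rule nonpos_exponent_if_bounded)
    fix N
    \<comment> \<open>From \<open>p > 2\<close> follow \<open>p / 4 \<le> (p - 1) / 2\<close> and
      \<open>p / 2 \<le> p - 1\<close>, so that only pure powers of \<open>p\<close> remain, at the
      cost of constants.\<close>
    obtain p where p: "p > max N 2" and
      le: "((real p - 1) / 2 * real p ^ (n - 2)) powr \<beta> * ((real p - 1) * sqrt (real p) ^ (n - 2))
        \<le> 2 * K * real p ^ (n - 1)" using test by blast
    define x where "x = real p"
    have x: "x > 2" using p by (simp add: x_def)
    have "x powr ((real n - 1) * \<beta>) = (4 * (x / 4 * x ^ (n - 2))) powr \<beta>"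
    proof -
      have "x * x ^ (n - 2) = x ^ (n - 1)"
        using n by (simp flip: power_Suc add: Suc_diff_Suc numeral_2_eq_2)
      then have "4 * (x / 4 * x ^ (n - 2)) = x powr (real n - 1)"
        using n x by (simp add: of_nat_diff flip: powr_realpow)
      then show ?thesis by (simp add: powr_powr)
    qed
    also have "\<dots> = 4 powr \<beta> * (x / 4 * x ^ (n - 2)) powr \<beta>" using x by (subst powr_mult) auto
    also have "\<dots> \<le> 4 * ((x - 1) / 2 * x ^ (n - 2)) powr \<beta>"
    proof (intro mult_mono powr_mono2)
      show "4 powr \<beta> \<le> (4::real)" using powr_mono[of \<beta> 1 4] \<beta> by simp
    qed (use x \<beta> in \<open>auto intro!: mult_right_mono\<close>)
    finally have "x powr ((real n - 1) * \<beta>) * (x / 2 * sqrt x ^ (n - 2))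
      \<le> 4 * ((x - 1) / 2 * x ^ (n - 2)) powr \<beta> * ((x - 1) * sqrt x ^ (n - 2))"
      using x by (intro mult_mono) (auto intro!: mult_right_mono)
    also have "\<dots> \<le> 4 * (2 * K * x ^ (n - 1))" using mult_left_mono[OF le, of 4] by (simp add: x_def mult_ac)
    also have "x ^ (n - 1) = x powr (real n - 1)"
      using n x by (simp add: of_nat_diff flip: powr_realpow)
    also have "sqrt x ^ (n - 2) = x powr ((real n - 2) / 2)"
      using n x by (simp add: powr_half_sqrt[symmetric] powr_powr of_nat_diff flip: powr_realpow)
    finally have le: "x powr ((real n - 1) * \<beta>) * (x / 2 * x powr ((real n - 2) / 2)) \<le> 8 * K * x powr (real n - 1)"
      by simp
    have "x powr ((real n - 1) * \<beta> - (real n - 2) / 2) * x powr (real n - 1)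
        = x powr ((real n - 1) * \<beta>) * (x powr 1 * x powr ((real n - 2) / 2))"
      unfolding powr_add[symmetric] by (rule arg_cong[where f = "\<lambda>t. x powr t"]) (simp add: field_simps)
    also have "\<dots> \<le> 16 * K * x powr (real n - 1)" using le x by simp
    finally have "x powr ((real n - 1) * \<beta> - (real n - 2) / 2) \<le> 16 * K" using x by simp
    then show "\<exists>p>N. real p powr ((real n - 1) * \<beta> - (real n - 2) / 2) \<le> 16 * K"
      using p by (auto simp: x_def)
  qed
  then show ?thesis using n by (simp add: field_simps)
qed

lemma isotropic_test_exponent:
  fixes \<alpha> \<beta> K :: real
  assumes k: "k < n" and \<alpha>: "0 \<le> \<alpha>" "\<alpha> \<le> 1"
    and test: "\<And>N. \<exists>p>N. (real p ^ (n - k)) powr \<beta> \<le> K * (2 * real p ^ (n - 1 - k)) powr (1 - \<alpha>)"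
  shows "(real n - real k) * \<beta> \<le> (real n - 1 - real k) * (1 - \<alpha>)"
proof -
  have "(real n - real k) * \<beta> - (real n - 1 - real k) * (1 - \<alpha>) \<le> 0"
  proof (rule nonpos_exponent_if_bounded)
    fix N
    obtain p where p: "p > N" and
      le: "(real p ^ (n - k)) powr \<beta> \<le> K * (2 * real p ^ (n - 1 - k)) powr (1 - \<alpha>)" using test by blast
    have x: "real p > 0" using p by simp
    have "real p powr ((real n - real k) * \<beta>) = (real p ^ (n - k)) powr \<beta>"
      using k x by (simp add: of_nat_diff powr_powr flip: powr_realpow)
    also note le
    also have "(2 * real p ^ (n - 1 - k)) powr (1 - \<alpha>)
        = 2 powr (1 - \<alpha>) * real p powr ((real n - 1 - real k) * (1 - \<alpha>))"
      using k x by (simp add: powr_mult of_nat_diff powr_powr diff_diff_eq flip: powr_realpow)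
    finally have "real p powr ((real n - real k) * \<beta> - (real n - 1 - real k) * (1 - \<alpha>)) \<le> K * 2 powr (1 - \<alpha>)"
      using x by (simp add: powr_diff pos_divide_le_eq mult.assoc)
    then show "\<exists>p>N. real p powr ((real n - real k) * \<beta> - (real n - 1 - real k) * (1 - \<alpha>)) \<le> K * 2 powr (1 - \<alpha>)"
      using p by blast
  qed
  then show ?thesis by simp
qed

section \<open>Membership in the quadrilateral\<close>

text \<open>Slice horizontally at height \<open>y\<close>: the slice runs from \<open>(0, y)\<close>
  on the left edge to \<open>(L, y)\<close> on the edge joining \<open>(1, 0)\<close> to
  \<open>(x0, y0)\<close>, and the slope condition says exactly \<open>x \<le> L\<close>.\<close>

lemma in_hull_quadrilateral:
  fixes x y x0 y0 :: real
  assumes x0: "0 \<le> x0" and y0: "0 < y0" and x: "0 \<le> x" and y: "0 \<le> y" "y \<le> y0"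
    and slope: "y * (1 - x0) \<le> y0 * (1 - x)"
  shows "(x, y) \<in> convex hull {(0, 0), (1, 0), (x0, y0), (0, y0)}" (is "_ \<in> ?H")
proof -
  define \<theta> where "\<theta> = y / y0"
  define L where "L = (1 - \<theta>) + \<theta> * x0"
  have \<theta>: "0 \<le> \<theta>" "\<theta> \<le> 1" "\<theta> * y0 = y" using y y0 by (auto simp: \<theta>_def)
  have "y0 * L = y0 - y * (1 - x0)" unfolding \<theta>(3)[symmetric] by (simp add: L_def algebra_simps)
  then have "y0 * x \<le> y0 * L" using slope by (simp add: algebra_simps)
  then have xL: "x \<le> L" using y0 by simp
  have "(1 - \<theta>) *\<^sub>R (0, 0) + \<theta> *\<^sub>R (0, y0) \<in> ?H" "(1 - \<theta>) *\<^sub>R (1, 0) + \<theta> *\<^sub>R (x0, y0) \<in> ?H"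
    using \<theta> by (intro convexD_alt convex_convex_hull hull_inc; simp)+
  then have ends: "(0, y) \<in> ?H" "(L, y) \<in> ?H" using \<theta> by (simp_all add: L_def)
  \<comment> \<open>If \<open>L = 0\<close> then \<open>x = 0\<close> as well, and division by zero
    gives the right value \<open>\<mu> = 0\<close>.\<close>
  define \<mu> where "\<mu> = x / L"
  have "(1 - \<mu>) *\<^sub>R (0, y) + \<mu> *\<^sub>R (L, y) \<in> ?H"
    using x xL ends by (intro convexD_alt convex_convex_hull) (auto simp: \<mu>_def divide_le_eq)
  moreover have "\<mu> * L = x" using x xL by (auto simp: \<mu>_def)
  ultimately show ?thesis by (simp add: algebra_simps)
qed

lemma odd_prime_fieldI: "prime p \<Longrightarrow> odd p \<Longrightarrow> odd_prime_field p"
  by unfold_locales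

section \<open>From uniform boundedness to the exponent inequalities\<close>

text \<open>\<open>P\<close> is the class of fields on which boundedness is assumed,
  \<open>Q\<close> an infinite set of primes whose residue fields lie in this class, and
  \<open>k\<close> the dimension of an isotropic subspace available for each of them.\<close>

lemma exponents_if_R_star_bounded:
  fixes s r :: ennreal
  assumes n: "n \<ge> 3" and k: "k < n" and s: "1 \<le> s" and r: "1 \<le> r"
    and bounded: "R_star_bounded n s r P"
    and large: "\<And>N. \<exists>p>N. Q p"
    and field: "\<And>p. Q p \<Longrightarrow> odd_prime_field p \<and> P (residue_ring (int p))"
    and isotropic: "\<And>p K. Q p \<Longrightarrow> r \<noteq> \<infinity> \<Longrightarrow> R_star (residue_ring (int p)) n s r \<le> K \<Longrightarrow>
      (real p ^ (n - k)) powr enn2real (1 / r) \<le> K * (2 * real p ^ (n - 1 - k)) powr (1 - enn2real (1 / s))"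
  shows "enn2real (1 / r) \<le> (real n - 2) / (2 * real n - 2)"
    and "(real n - real k) * enn2real (1 / r) \<le> (real n - 1 - real k) * (1 - enn2real (1 / s))"
proof -
  have \<alpha>: "0 \<le> enn2real (1 / s)" "enn2real (1 / s) \<le> 1" using enn2real_one_divide(3,4)[OF s] by auto
  have \<beta>: "0 \<le> enn2real (1 / r)" "enn2real (1 / r) \<le> 1" using enn2real_one_divide(3,4)[OF r] by auto
  have "enn2real (1 / r) \<le> (real n - 2) / (2 * real n - 2) \<and>
    (real n - real k) * enn2real (1 / r) \<le> (real n - 1 - real k) * (1 - enn2real (1 / s))"
  proof (cases "r = \<infinity>")
    \<comment> \<open>Here \<open>1 / r\<close> is 0, and both right-hand sides are
      nonnegative.\<close>
    case True
    then show ?thesis using n k \<alpha> by auto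
  next
    case False
    obtain K where K: "\<And>F. odd_finite_field F \<Longrightarrow> P F \<Longrightarrow> R_star F n s r \<le> K"
      using bounded unfolding R_star_bounded_def by blast
    have K': "R_star (residue_ring (int p)) n s r \<le> K" if "Q p" for p
      using field[OF that] by (intro K odd_prime_field.odd_finite_field) auto
    show ?thesis
    proof
      show "enn2real (1 / r) \<le> (real n - 2) / (2 * real n - 2)"
      proof (rule cone_test_exponent[OF n \<beta>])
        fix N
        obtain p where p: "p > N" "Q p" using large by blast
        interpret odd_prime_field p "residue_ring (int p)" using field[OF p(2)] by simp_all
        show "\<exists>p>N. ((real p - 1) / 2 * real p ^ (n - 2)) powr enn2real (1 / r) *
            ((real p - 1) * sqrt (real p) ^ (n - 2)) \<le> 2 * K * real p ^ (n - 1)"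
          using cone_test[OF n s r False K'[OF p(2)]] p(1) by blast
      qed
      show "(real n - real k) * enn2real (1 / r) \<le> (real n - 1 - real k) * (1 - enn2real (1 / s))"
      proof (rule isotropic_test_exponent[OF k \<alpha>])
        fix N
        obtain p where "p > N" "Q p" using large by blast
        then show "\<exists>p>N. (real p ^ (n - k)) powr enn2real (1 / r)
            \<le> K * (2 * real p ^ (n - 1 - k)) powr (1 - enn2real (1 / s))"
          using isotropic[OF _ False K'] by blast
      qed
    qed
  qed
  then show "enn2real (1 / r) \<le> (real n - 2) / (2 * real n - 2)"
    and "(real n - real k) * enn2real (1 / r) \<le> (real n - 1 - real k) * (1 - enn2real (1 / s))" by auto
qed

lemma exponents_minus_one_square:
  fixes s r :: ennreal
  assumes n: "n \<ge> 3" and s: "1 \<le> s" and r: "1 \<le> r"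
    and bounded: "R_star_bounded n s r (\<lambda>F. minus_one_is_square F)"
  shows "enn2real (1 / r) \<le> (real n - 2) / (2 * real n - 2)"
    and "(real n - real (n div 2)) * enn2real (1 / r)
      \<le> (real n - 1 - real (n div 2)) * (1 - enn2real (1 / s))"
proof -
  define Q where "Q p \<longleftrightarrow> prime p \<and> odd p \<and> (\<exists>b. [b\<^sup>2 = - 1] (mod int p))" for p :: nat
  have large: "\<exists>p>N. Q p" for N
    by (rule prime_minus_one_square[of N]) (auto simp: Q_def)
  have k: "n div 2 < n" using n by simp
  have field: "odd_prime_field p \<and> minus_one_is_square (residue_ring (int p))" if "Q p" for p
    using that odd_prime_fieldI odd_prime_field.minus_one_is_square_iff by (auto simp: Q_def)
  have test: "(real p ^ (n - n div 2)) powr enn2real (1 / r)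
      \<le> K * (2 * real p ^ (n - 1 - n div 2)) powr (1 - enn2real (1 / s))"
    if "Q p" "r \<noteq> \<infinity>" "R_star (residue_ring (int p)) n s r \<le> K" for p K
    using that field[OF that(1)] odd_prime_field.isotropic_test_minus_one_square[OF _ n s r]
    by (auto simp: Q_def)
  from exponents_if_R_star_bounded[OF n k s r bounded large field test]
  show "enn2real (1 / r) \<le> (real n - 2) / (2 * real n - 2)"
    and "(real n - real (n div 2)) * enn2real (1 / r)
      \<le> (real n - 1 - real (n div 2)) * (1 - enn2real (1 / s))" by auto
qed

text \<open>Primes congruent to 3 modulo 4 keep the tested fields in the class where -1 is not a
  square, while -2 being a square supplies the isotropic subspace of dimension
  \<open>(n - 2) div 2\<close>.\<close>

lemma exponents_minus_one_not_square:
  fixes s r :: ennreal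
  assumes n: "n \<ge> 3" "n mod 4 = 0" and s: "1 \<le> s" and r: "1 \<le> r"
    and bounded: "R_star_bounded n s r (\<lambda>F. \<not> minus_one_is_square F)"
  shows "enn2real (1 / r) \<le> (real n - 2) / (2 * real n - 2)"
    and "(real n - real ((n - 2) div 2)) * enn2real (1 / r)
      \<le> (real n - 1 - real ((n - 2) div 2)) * (1 - enn2real (1 / s))"
proof -
  define Q where "Q p \<longleftrightarrow> prime p \<and> p mod 4 = 3 \<and> (\<exists>b. [b\<^sup>2 = - 2] (mod int p))" for p :: nat
  have large: "\<exists>p>N. Q p" for N
    by (rule prime_minus_two_square[of N]) (auto simp: Q_def)
  have k: "(n - 2) div 2 < n" using n by simp
  have field: "odd_prime_field p \<and> \<not> minus_one_is_square (residue_ring (int p))" if "Q p" for p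
  proof -
    have p: "prime p" "p mod 4 = 3" using that by (auto simp: Q_def)
    moreover have "odd p" using p(2) by presburger
    ultimately have "odd_prime_field p" by (intro odd_prime_fieldI)
    then show ?thesis
      using not_square_minus_one[OF p] by (simp add: odd_prime_field.minus_one_is_square_iff)
  qed
  have test: "(real p ^ (n - (n - 2) div 2)) powr enn2real (1 / r)
      \<le> K * (2 * real p ^ (n - 1 - (n - 2) div 2)) powr (1 - enn2real (1 / s))"
    if "Q p" "r \<noteq> \<infinity>" "R_star (residue_ring (int p)) n s r \<le> K" for p K
    using that field[OF that(1)] odd_prime_field.isotropic_test_minus_two_square[OF _ n s r]
    by (auto simp: Q_def)
  from exponents_if_R_star_bounded[OF n(1) k s r bounded large field test]
  show "enn2real (1 / r) \<le> (real n - 2) / (2 * real n - 2)"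
    and "(real n - real ((n - 2) div 2)) * enn2real (1 / r)
      \<le> (real n - 1 - real ((n - 2) div 2)) * (1 - enn2real (1 / s))" by auto
qed

text \<open>Here \<open>d\<close> stands for \<open>n - k\<close>. The equation for \<open>d\<close>
  puts the vertex \<open>(x0, y0)\<close> on the line \<open>d * y = (d - 1) * (1 - x)\<close>,
  which also contains \<open>(1, 0)\<close>; the isotropic bound therefore describes the slanted
  edge.\<close>

lemma in_hull_if_exponent_bounds:
  fixes x y x0 y0 d :: real
  assumes x0: "0 \<le> x0" "x0 \<le> 1" and y0: "0 < y0" and x: "0 \<le> x" and y: "0 \<le> y" "y \<le> y0"
    and d: "0 < d" "(1 - x0) * (d - 1) = y0 * d" and le: "d * y \<le> (d - 1) * (1 - x)"
  shows "(x, y) \<in> convex hull {(0, 0), (1, 0), (x0, y0), (0, y0)}"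
proof (rule in_hull_quadrilateral)
  have "d * (y * (1 - x0)) \<le> (d - 1) * (1 - x) * (1 - x0)"
    using mult_right_mono[OF le, of "1 - x0"] x0 by (simp add: mult_ac)
  also have "\<dots> = d * (y0 * (1 - x))" using d(2) by (simp add: mult_ac)
  finally show "y * (1 - x0) \<le> y0 * (1 - x)" using d(1) by simp
qed (use assms in auto)

theorem lemma1p2:
  fixes n :: nat and p r :: ennreal
  assumes "n \<ge> 3" and "1 \<le> p" and "1 \<le> r"
  shows "(odd n \<longrightarrow> R_star_bounded n p r (\<lambda>F. True) \<longrightarrow>
            (enn2real (1 / p), enn2real (1 / r)) \<in> convex hull
              {(0, 0), (1, 0),
               ((real n ^ 2 - 3 * real n + 4) / (2 * real n ^ 2 - 4 * real n + 2),
                (real n - 2) / (2 * real n - 2)),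
               (0, (real n - 2) / (2 * real n - 2))})
       \<and> ((n mod 4 = 2 \<and> R_star_bounded n p r (\<lambda>F. True)
             \<or> even n \<and> R_star_bounded n p r (\<lambda>F. minus_one_is_square F)) \<longrightarrow>
            (enn2real (1 / p), enn2real (1 / r)) \<in> convex hull
              {(0, 0), (1, 0),
               ((real n - 2) / (2 * real n - 2), (real n - 2) / (2 * real n - 2)),
               (0, (real n - 2) / (2 * real n - 2))})
       \<and> (n mod 4 = 0 \<longrightarrow> R_star_bounded n p r (\<lambda>F. \<not> minus_one_is_square F) \<longrightarrow>
            (enn2real (1 / p), enn2real (1 / r)) \<in> convex hull
              {(0, 0), (1, 0),
               ((real n ^ 2 - 2 * real n + 4) / (2 * real n ^ 2 - 2 * real n),
                (real n - 2) / (2 * real n - 2)),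
               (0, (real n - 2) / (2 * real n - 2))})"
proof -
  let ?y0 = "(real n - 2) / (2 * real n - 2)"
  note n = assms(1)
  have x: "0 \<le> enn2real (1 / p)" and y: "0 \<le> enn2real (1 / r)"
    using enn2real_one_divide(3) assms(2,3) by blast+
  have y0: "0 < ?y0" using n by simp
  note hull = in_hull_if_exponent_bounds[OF _ _ y0 x y]
  have square: "R_star_bounded n p r (\<lambda>F. minus_one_is_square F)" if "R_star_bounded n p r (\<lambda>F. True)"
    using that by (auto simp: R_star_bounded_def)
  show ?thesis
  proof (intro conjI impI)
    assume odd: "odd n" and "R_star_bounded n p r (\<lambda>F. True)"
    note bounds = exponents_minus_one_square[OF assms square[OF this(2)]]
    have half: "real (n div 2) = (real n - 1) / 2" using odd by (auto elim!: oddE)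
    have *: "2 * real n ^ 2 - 4 * real n + 2 = 2 * (real n - 1) ^ 2"
      "2 * real n - 2 = 2 * (real n - 1)" by (simp_all add: power2_eq_square algebra_simps)
    \<comment> \<open>The numerator is the first product plus 4. The denominator minus the numerator
      is the second product, so the abscissa of the vertex is at most 1.\<close>
    have ge: "0 \<le> (real n - 3) * real n" "0 \<le> (real n - 2) * (real n + 1)" using n by auto
    show "(enn2real (1 / p), enn2real (1 / r)) \<in> convex hull {(0, 0), (1, 0),
        ((real n ^ 2 - 3 * real n + 4) / (2 * real n ^ 2 - 4 * real n + 2), ?y0), (0, ?y0)}"
    \<comment> \<open>The value is \<open>n - n div 2\<close> for odd \<open>n\<close>, the
      codimension of the isotropic subspace.\<close>
    proof (rule hull[where d = "(real n + 1) / 2"])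
      show "0 \<le> (real n ^ 2 - 3 * real n + 4) / (2 * real n ^ 2 - 4 * real n + 2)"
        unfolding * using ge by (intro divide_nonneg_nonneg) (auto simp: power2_eq_square algebra_simps)
      have pos: "0 < 2 * (real n - 1) ^ 2" using n by simp
      show "(real n ^ 2 - 3 * real n + 4) / (2 * real n ^ 2 - 4 * real n + 2) \<le> 1"
        unfolding * using ge by (subst divide_le_eq_1_pos[OF pos]) (auto simp: power2_eq_square algebra_simps)
      show "(1 - (real n ^ 2 - 3 * real n + 4) / (2 * real n ^ 2 - 4 * real n + 2)) * ((real n + 1) / 2 - 1)
          = ?y0 * ((real n + 1) / 2)"
        unfolding * using n by (simp add: divide_simps; simp add: power2_eq_square algebra_simps)
    qed (use bounds n in \<open>auto simp: half field_simps\<close>)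
  next
    assume "n mod 4 = 2 \<and> R_star_bounded n p r (\<lambda>F. True)
      \<or> even n \<and> R_star_bounded n p r (\<lambda>F. minus_one_is_square F)"
    \<comment> \<open>The first alternative reduces to the second: a bound over all fields holds in
      particular over those in which -1 is a square.\<close>
    moreover have "even n" if "n mod 4 = 2" using that by presburger
    ultimately have even: "even n" and "R_star_bounded n p r (\<lambda>F. minus_one_is_square F)"
      using square by auto
    note bounds = exponents_minus_one_square[OF assms this(2)]
    have half: "real (n div 2) = real n / 2" using even by (auto elim!: evenE)
    show "(enn2real (1 / p), enn2real (1 / r)) \<in> convex hull {(0, 0), (1, 0), (?y0, ?y0), (0, ?y0)}"
    proof (rule hull[where d = "real n / 2"])
      show "(1 - ?y0) * (real n / 2 - 1) = ?y0 * (real n / 2)"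
        using n by (simp add: divide_simps; simp add: algebra_simps)
    qed (use bounds n in \<open>auto simp: half field_simps\<close>)
  next
    assume mod4: "n mod 4 = 0" and "R_star_bounded n p r (\<lambda>F. \<not> minus_one_is_square F)"
    note bounds = exponents_minus_one_not_square[OF n mod4 assms(2,3) this(2)]
    have "n = 2 * ((n - 2) div 2) + 2" using mod4 n by presburger
    then obtain j where j: "n = 2 * j + 2" by blast
    have half: "real ((n - 2) div 2) = (real n - 2) / 2" by (simp add: j)
    have *: "2 * real n ^ 2 - 2 * real n = 2 * real n * (real n - 1)"
      "2 * real n - 2 = 2 * (real n - 1)" by (simp_all add: power2_eq_square algebra_simps)
    have "real n ^ 2 - 2 * real n + 4 = (real n - 2) * real n + 4"
      by (simp add: power2_eq_square algebra_simps)
    also have "0 \<le> \<dots>" using n by simp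
    \<comment> \<open>The second product is the denominator minus the numerator of the
      abscissa.\<close>
    finally have ge: "0 \<le> real n ^ 2 - 2 * real n + 4" "0 \<le> (real n - 2) * (real n + 2)" using n by auto
    show "(enn2real (1 / p), enn2real (1 / r)) \<in> convex hull {(0, 0), (1, 0),
        ((real n ^ 2 - 2 * real n + 4) / (2 * real n ^ 2 - 2 * real n), ?y0), (0, ?y0)}"
    proof (rule hull[where d = "(real n + 2) / 2"])
      show "0 \<le> (real n ^ 2 - 2 * real n + 4) / (2 * real n ^ 2 - 2 * real n)"
        unfolding * using ge(1) n by (intro divide_nonneg_nonneg) auto
      show "(real n ^ 2 - 2 * real n + 4) / (2 * real n ^ 2 - 2 * real n) \<le> 1"
        unfolding * using ge n by (subst divide_le_eq_1_pos) (auto simp: power2_eq_square algebra_simps)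
      show "(1 - (real n ^ 2 - 2 * real n + 4) / (2 * real n ^ 2 - 2 * real n)) * ((real n + 2) / 2 - 1)
          = ?y0 * ((real n + 2) / 2)"
        unfolding * using n by (simp add: divide_simps; simp add: power2_eq_square algebra_simps)
    qed (use bounds n in \<open>auto simp: half field_simps\<close>)
  qed
qed

end
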